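(* Let $\mathbb{F}$ be a field. The two-parameter persistence module $PH_1(Y^2_{-,-};\mathbb{F})$ associated with the second configuration spaces of the metric $Y$-graph is an interval module (up to isomorphism); hence it is indecomposable.
   Context: Metric graph and configuration spaces: $Y$ is the geometric realization of the tree with one central vertex and three edges $e_1,e_2,e_3$, each joining the central vertex to a leaf. For $L>0$, $Y_L$ is $Y$ with the path metric $\delta_L$ in which $e_1$ has length $L=L_{e_1}$ and $e_2,e_3$ have length $1$ (each edge is a fixed copy of $[0,1]$, rescaled linearly to its length, so that only the metric, not the underlying space, depends on $L$). For $r>0$, $Y^2_{r,L}=\{(x,y)\in Y\times Y\mid \delta_L(x,y)\ge r\}$. Poset and persistence module: let $P=(\mathbb{R}_{>0},\le)^{\mathrm{op}}\times(\mathbb{R}_{>0},\le)$, i.e. pairs $(r,L)$ with $(r,L)\le (r',L')$ iff $r'\le r$ and $L\le L'$. If $(r,L)\le(r',L')$ then $Y^2_{r,L}\subseteq Y^2_{r',L'}$. A persistence module over $P$ is a functor $P\to \mathrm{Vect}_{\mathbb{F}}$. $PH_i(Y^2_{-,-};\mathbb{F})$ is the persistence module $(r,L)\mapsto H_i(Y^2_{r,L};\mathbb{F})$ (singular homology) with maps induced by the inclusions. Interval modules: a subset $I\subseteq P$ is an interval if it is connected (as a poset) and convex ($a\le b\le c$, $a,c\in I$ imply $b\in I$). The interval module $\mathbb{F}I$ has $\mathbb{F}I(t)=\mathbb{F}$ for $t\in I$, $0$ otherwise, with structure map the identity for $s\le t$ both in $I$ and $0$ otherwise. A module is indecomposable if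 it is not a direct sum of two nonzero submodules. *)

theory Defs
  imports "HOL-Homology.Homology"
begin

section \<open>Vector spaces over a field\<close>

text \<open>The field is a type \<open>'f\<close> of class \<^class>\<open>field\<close>; a vector space over it is a module, in the
  sense of HOL-Algebra, over the following ring. The fields \<open>mult\<close> and \<open>one\<close> of the record of a
  module play no role there.\<close>

definition scalar_field :: "'f::field ring" where
  "scalar_field = \<lparr>carrier = UNIV, mult = (*), one = 1, zero = 0, add = (+)\<rparr>"

abbreviation vector_space_over_field :: "('f::field, 'v) module \<Rightarrow> bool" where
  "vector_space_over_field V \<equiv> Module.module scalar_field V"

definition linear_maps ::
    "('f::field, 'v) module \<Rightarrow> ('f, 'w) module \<Rightarrow> ('v \<Rightarrow> 'w) set" where
  "linear_maps V W =
    {h \<in> carrier V \<rightarrow> carrier W.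
      (\<forall>u\<in>carrier V. \<forall>v\<in>carrier V. h (u \<oplus>\<^bsub>V\<^esub> v) = h u \<oplus>\<^bsub>W\<^esub> h v) \<and>
      (\<forall>a. \<forall>v\<in>carrier V. h (a \<odot>\<^bsub>V\<^esub> v) = a \<odot>\<^bsub>W\<^esub> h v)}"


section \<open>Persistence modules over a poset\<close>

text \<open>The poset is given by a carrier set \<open>P\<close> and a relation \<open>leq\<close>. A persistence module assigns
  a vector space to each index and a linear map \<open>pmap M s t\<close> to each relation \<open>s \<le> t\<close>; values of
  \<open>pspace\<close> and \<open>pmap\<close> at other arguments are irrelevant.\<close>

record ('p, 'f, 'v) pmodule =
  pspace :: "'p \<Rightarrow> ('f, 'v) module"
  pmap :: "'p \<Rightarrow> 'p \<Rightarrow> 'v \<Rightarrow> 'v"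

definition persistence_module ::
    "'p set \<Rightarrow> ('p \<Rightarrow> 'p \<Rightarrow> bool) \<Rightarrow> ('p, 'f::field, 'v) pmodule \<Rightarrow> bool" where
  "persistence_module P leq M \<longleftrightarrow>
    (\<forall>t\<in>P. vector_space_over_field (pspace M t)) \<and>
    (\<forall>s\<in>P. \<forall>t\<in>P. leq s t \<longrightarrow> pmap M s t \<in> linear_maps (pspace M s) (pspace M t)) \<and>
    (\<forall>t\<in>P. \<forall>v\<in>carrier (pspace M t). pmap M t t v = v) \<and>
    (\<forall>s\<in>P. \<forall>t\<in>P. \<forall>u\<in>P. leq s t \<longrightarrow> leq t u \<longrightarrow>
      (\<forall>v\<in>carrier (pspace M s). pmap M s u v = pmap M t u (pmap M s t v)))"

definition pmodule_iso ::
    "'p set \<Rightarrow> ('p \<Rightarrow> 'p \<Rightarrow> bool) \<Rightarrow> ('p, 'f::field, 'v) pmodule \<Rightarrow> ('p, 'f, 'w) pmodule \<Rightarrow> bool" where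
  "pmodule_iso P leq M N \<longleftrightarrow>
    (\<exists>\<eta>. (\<forall>t\<in>P. \<eta> t \<in> linear_maps (pspace M t) (pspace N t) \<and>
                bij_betw (\<eta> t) (carrier (pspace M t)) (carrier (pspace N t))) \<and>
         (\<forall>s\<in>P. \<forall>t\<in>P. leq s t \<longrightarrow>
            (\<forall>v\<in>carrier (pspace M s). \<eta> t (pmap M s t v) = pmap N s t (\<eta> s v))))"

definition poset_connected :: "('p \<Rightarrow> 'p \<Rightarrow> bool) \<Rightarrow> 'p set \<Rightarrow> bool" where
  "poset_connected leq I \<longleftrightarrow> I \<noteq> {} \<and>
    (\<forall>a\<in>I. \<forall>b\<in>I. (a, b) \<in> {(x, y). x \<in> I \<and> y \<in> I \<and> (leq x y \<or> leq y x)}\<^sup>*)"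

definition poset_convex :: "'p set \<Rightarrow> ('p \<Rightarrow> 'p \<Rightarrow> bool) \<Rightarrow> 'p set \<Rightarrow> bool" where
  "poset_convex P leq I \<longleftrightarrow> (\<forall>a\<in>I. \<forall>b\<in>P. \<forall>c\<in>I. leq a b \<longrightarrow> leq b c \<longrightarrow> b \<in> I)"

definition poset_interval :: "'p set \<Rightarrow> ('p \<Rightarrow> 'p \<Rightarrow> bool) \<Rightarrow> 'p set \<Rightarrow> bool" where
  "poset_interval P leq I \<longleftrightarrow> I \<subseteq> P \<and> poset_connected leq I \<and> poset_convex P leq I"

definition interval_module :: "'p set \<Rightarrow> ('p, 'f::field, 'f) pmodule" where
  "interval_module I =
    \<lparr>pspace = (\<lambda>t. \<lparr>carrier = (if t \<in> I then UNIV else {0}), mult = (*), one = 1,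
                    zero = 0, add = (+), smult = (*)\<rparr>),
     pmap = (\<lambda>s t. if s \<in> I \<and> t \<in> I then (\<lambda>v. v) else (\<lambda>v. 0))\<rparr>"

definition persistence_submodule ::
    "'p set \<Rightarrow> ('p \<Rightarrow> 'p \<Rightarrow> bool) \<Rightarrow> ('p \<Rightarrow> 'v set) \<Rightarrow> ('p, 'f::field, 'v) pmodule \<Rightarrow> bool" where
  "persistence_submodule P leq U M \<longleftrightarrow>
    (\<forall>t\<in>P. submodule (U t) scalar_field (pspace M t)) \<and>
    (\<forall>s\<in>P. \<forall>t\<in>P. leq s t \<longrightarrow> pmap M s t ` U s \<subseteq> U t)"

definition nonzero_submodule :: "'p set \<Rightarrow> ('p \<Rightarrow> 'v set) \<Rightarrow> ('p, 'f::field, 'v) pmodule \<Rightarrow> bool" where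
  "nonzero_submodule P U M \<longleftrightarrow> (\<exists>t\<in>P. U t \<noteq> {\<zero>\<^bsub>pspace M t\<^esub>})"

definition internal_direct_sum ::
    "'p set \<Rightarrow> ('p \<Rightarrow> 'v set) \<Rightarrow> ('p \<Rightarrow> 'v set) \<Rightarrow> ('p, 'f::field, 'v) pmodule \<Rightarrow> bool" where
  "internal_direct_sum P U W M \<longleftrightarrow>
    (\<forall>t\<in>P. \<forall>v\<in>carrier (pspace M t). \<exists>!(u, w). u \<in> U t \<and> w \<in> W t \<and> v = u \<oplus>\<^bsub>pspace M t\<^esub> w)"

definition indecomposable ::
    "'p set \<Rightarrow> ('p \<Rightarrow> 'p \<Rightarrow> bool) \<Rightarrow> ('p, 'f::field, 'v) pmodule \<Rightarrow> bool" where
  "indecomposable P leq M \<longleftrightarrow>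
    \<not> (\<exists>U W. persistence_submodule P leq U M \<and> persistence_submodule P leq W M \<and>
             nonzero_submodule P U M \<and> nonzero_submodule P W M \<and>
             internal_direct_sum P U W M)"


section \<open>Singular homology with coefficients in a field\<close>

text \<open>HOL-Homology fixes integer coefficients. The simplices and face maps are the ones from
  there; chains are finitely supported functions from simplices to the field.\<close>

type_synonym ('a, 'f) field_chain = "((nat \<Rightarrow> real) \<Rightarrow> 'a) \<Rightarrow>\<^sub>0 'f"

definition field_chains :: "nat \<Rightarrow> 'a topology \<Rightarrow> ('a, 'f::field) field_chain set" where
  "field_chains p X = {c. Poly_Mapping.keys c \<subseteq> singular_simplex_set p X}"

definition chain_smult :: "'f::field \<Rightarrow> ('a, 'f) field_chain \<Rightarrow> ('a, 'f) field_chain" where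
  "chain_smult a c = Poly_Mapping.map ((*) a) c"

definition field_boundary :: "nat \<Rightarrow> ('a, 'f::field) field_chain \<Rightarrow> ('a, 'f) field_chain" where
  "field_boundary p c =
    (if p = 0 then 0
     else \<Sum>\<sigma>\<in>Poly_Mapping.keys c. \<Sum>k\<le>p.
            Poly_Mapping.single (singular_face p k \<sigma>) ((- 1) ^ k * Poly_Mapping.lookup c \<sigma>))"

definition field_chain_map ::
    "nat \<Rightarrow> ('a \<Rightarrow> 'b) \<Rightarrow> ('a, 'f::field) field_chain \<Rightarrow> ('b, 'f) field_chain" where
  "field_chain_map p g c =
    (\<Sum>\<sigma>\<in>Poly_Mapping.keys c.
       Poly_Mapping.single (simplex_map p g \<sigma>) (Poly_Mapping.lookup c \<sigma>))"

definition field_cycles :: "nat \<Rightarrow> 'a topology \<Rightarrow> ('a, 'f::field) field_chain set" where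
  "field_cycles p X = {c \<in> field_chains p X. field_boundary p c = 0}"

definition field_boundaries :: "nat \<Rightarrow> 'a topology \<Rightarrow> ('a, 'f::field) field_chain set" where
  "field_boundaries p X = field_boundary (Suc p) ` field_chains (Suc p) X"

definition homology_class ::
    "nat \<Rightarrow> 'a topology \<Rightarrow> ('a, 'f::field) field_chain \<Rightarrow> ('a, 'f) field_chain set" where
  "homology_class p X c = (\<lambda>b. c + b) ` field_boundaries p X"

text \<open>Cycles modulo boundaries, as cosets. The unions are again single cosets when the arguments
  are cosets.\<close>

definition field_homology ::
    "nat \<Rightarrow> 'a topology \<Rightarrow> ('f::field, ('a, 'f) field_chain set) module" where
  "field_homology p X =
    \<lparr>carrier = homology_class p X ` field_cycles p X,
     mult = undefined, one = undefined,
     zero = homology_class p X 0,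
     add = (\<lambda>A B. \<Union>a\<in>A. \<Union>b\<in>B. homology_class p X (a + b)),
     smult = (\<lambda>k A. \<Union>a\<in>A. homology_class p X (chain_smult k a))\<rparr>"

definition field_hom_induced ::
    "nat \<Rightarrow> 'b topology \<Rightarrow> ('a \<Rightarrow> 'b) \<Rightarrow> ('a, 'f::field) field_chain set \<Rightarrow> ('b, 'f) field_chain set"
  where
  "field_hom_induced p X' g A = (\<Union>a\<in>A. homology_class p X' (field_chain_map p g a))"


section \<open>The metric Y-graph and its second configuration spaces\<close>

text \<open>A point of the geometric realization is given by its barycentric coordinates at the three
  leaves; the coordinate at the central vertex, which is one minus their sum, is omitted. So the
  central vertex is \<open>0\<close>, the leaves are the standard unit vectors, and \<open>edge_point i t\<close> is the
  point with parameter \<open>t\<close> on the copy \<open>e\<^sub>i\<close> of the unit interval, measured from the centre.\<close>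

definition edge_point :: "3 \<Rightarrow> real \<Rightarrow> real ^ 3" where
  "edge_point i t = t *\<^sub>R axis i 1"

definition Y_graph :: "(real ^ 3) set" where
  "Y_graph = (\<Union>i. edge_point i ` {0..1})"

definition edge_length :: "real \<Rightarrow> 3 \<Rightarrow> real" where
  "edge_length L i = (if i = 1 then L else 1)"

text \<open>\<open>pl_path L x y d\<close>: there is a piecewise linear path of length \<open>d\<close> from \<open>x\<close> to \<open>y\<close>, i.e. a
  concatenation of finitely many segments, each contained in one edge.\<close>

inductive pl_path :: "real \<Rightarrow> real ^ 3 \<Rightarrow> real ^ 3 \<Rightarrow> real \<Rightarrow> bool" for L where
  pl_refl: "x \<in> Y_graph \<Longrightarrow> pl_path L x x 0"
| pl_step: "\<lbrakk>s \<in> {0..1}; t \<in> {0..1}; pl_path L (edge_point i t) y d\<rbrakk>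
    \<Longrightarrow> pl_path L (edge_point i s) y (edge_length L i * \<bar>s - t\<bar> + d)"

definition path_metric :: "real \<Rightarrow> real ^ 3 \<Rightarrow> real ^ 3 \<Rightarrow> real" where
  "path_metric L x y = Inf {d. pl_path L x y d}"

definition Y_conf2 :: "real \<Rightarrow> real \<Rightarrow> ((real ^ 3) \<times> (real ^ 3)) set" where
  "Y_conf2 r L = {(x, y). x \<in> Y_graph \<and> y \<in> Y_graph \<and> path_metric L x y \<ge> r}"

definition param_poset :: "(real \<times> real) set" where
  "param_poset = {(r, L). 0 < r \<and> 0 < L}"

fun param_le :: "real \<times> real \<Rightarrow> real \<times> real \<Rightarrow> bool" where
  "param_le (r, L) (r', L') \<longleftrightarrow> r' \<le> r \<and> L \<le> L'"

definition Y_conf2_space :: "real \<times> real \<Rightarrow> ((real ^ 3) \<times> (real ^ 3)) topology" where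
  "Y_conf2_space = (\<lambda>(r, L). top_of_set (Y_conf2 r L))"

type_synonym 'f Y_pmodule =
  "(real \<times> real, 'f, ((real ^ 3) \<times> (real ^ 3), 'f) field_chain set) pmodule"

definition PH_Y :: "nat \<Rightarrow> 'f::field Y_pmodule" where
  "PH_Y i =
    \<lparr>pspace = (\<lambda>t. field_homology i (Y_conf2_space t)),
     pmap = (\<lambda>s t. field_hom_induced i (Y_conf2_space t) (\<lambda>x. x))\<rparr>"


end

theory Submission
  imports Defs "HOL-Analysis.Analysis"
begin

text \<open>On the Y-graph the path metric is a weighted \<open>\<ell>\<^sup>1\<close>-norm of the difference vector
  \<open>v = x - y\<close>. This vector has median coordinate \<open>0\<close>, and the vectors with this property form a
  topological plane. Moving \<open>(x, y)\<close> on a straight line to the positive and negative parts of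
  \<open>v / max \<bar>v\<^sub>i\<bar>\<close> does not decrease the distance, so the configuration space is homotopy
  equivalent to a subset \<open>A\<close> of the circle of directions in this plane. Now \<open>A\<close> is the whole circle
  iff \<open>r \<le> min 1 L\<close>; otherwise a path in \<open>A\<close> is determined up to homotopy by its endpoints and
  the first homology vanishes. In the former case the winding number of the direction of \<open>v\<close>,
  which does not depend on the parameters, is an isomorphism from the first homology to the field.
  The parameters with \<open>r \<le> min 1 L\<close> form an up-closed directed set.\<close>

section \<open>Field chains and homology classes\<close>

text \<open>The threshold min 1 L comes from the configurations at the end of the straight-line
  motion. Some coordinate of the scaled difference is 1 or -1, so one point is at a leaf and the
  distance is at least the length of that edge, with equality when the other point is at the centre.
  Directions towards the shortest edge are thus the first to be lost as r grows. To treat this case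
  along with the full circle, everything is done with chains: up to boundaries of explicit triangles
  and squares, a path equals an arc between two real angles plus corrections that depend on its ends
  alone, and such corrections cancel in a cycle. Angles are kept as reals, not modulo full turns, so
  that an arc still shows how often it winds.\<close>

lemma lookup_chain_smult [simp]:
  "Poly_Mapping.lookup (chain_smult a c) k = a * Poly_Mapping.lookup c k"
  by (simp add: chain_smult_def map.rep_eq when_def)

global_interpretation chain: vector_space "chain_smult :: 'f::field \<Rightarrow> ('a, 'f) field_chain \<Rightarrow> _"
  by unfold_locales (auto intro!: poly_mapping_eqI simp: lookup_add algebra_simps)

lemma chain_smult_single: "chain_smult a (Poly_Mapping.single k b) = Poly_Mapping.single k (a * b)"
  by (auto intro!: poly_mapping_eqI simp: lookup_single when_def)

text \<open>The scalar multiplication is an argument so that one construction serves for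
  chain-valued maps, such as the boundary, and for field-valued functionals, such as the winding
  number.\<close>

definition linear_ext ::
    "('f::field \<Rightarrow> 'm \<Rightarrow> 'm) \<Rightarrow> ('k \<Rightarrow> 'm) \<Rightarrow> ('k \<Rightarrow>\<^sub>0 'f) \<Rightarrow> 'm::ab_group_add" where
  "linear_ext sc f c = (\<Sum>k\<in>Poly_Mapping.keys c. sc (Poly_Mapping.lookup c k) (f k))"

context vector_space
begin

text \<open>Keys can disappear by cancellation, so sums over the keys of different chains are
  compared over a common finite set; the additional terms have coefficient \<open>0\<close>.\<close>

lemma linear_ext_superset:
  assumes "finite K" "Poly_Mapping.keys c \<subseteq> K"
  shows "linear_ext scale f c = (\<Sum>k\<in>K. Poly_Mapping.lookup c k *s f k)"
  unfolding linear_ext_def using assms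
  by (intro sum.mono_neutral_left) (auto simp: in_keys_iff)

lemma linear_ext_0 [simp]: "linear_ext scale f 0 = 0"
  by (simp add: linear_ext_def)

lemma linear_ext_add: "linear_ext scale f (c + d) = linear_ext scale f c + linear_ext scale f d"
proof -
  define K where "K = Poly_Mapping.keys c \<union> Poly_Mapping.keys d"
  have "finite K" "Poly_Mapping.keys c \<subseteq> K" "Poly_Mapping.keys d \<subseteq> K"
    "Poly_Mapping.keys (c + d) \<subseteq> K"
    using keys_add [of c d] by (auto simp: K_def)
  then show ?thesis
    by (simp add: linear_ext_superset [of K] lookup_add scale_left_distrib sum.distrib)
qed

lemma linear_ext_minus: "linear_ext scale f (- c) = - linear_ext scale f c"
  by (metis add.inverse_inverse add_eq_0_iff linear_ext_0 linear_ext_add)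

lemma linear_ext_diff: "linear_ext scale f (c - d) = linear_ext scale f c - linear_ext scale f d"
  by (metis diff_conv_add_uminus linear_ext_add linear_ext_minus)

lemma linear_ext_sum: "linear_ext scale f (\<Sum>i\<in>A. c i) = (\<Sum>i\<in>A. linear_ext scale f (c i))"
  by (induction A rule: infinite_finite_induct) (auto simp: linear_ext_add)

lemma linear_ext_single [simp]: "linear_ext scale f (Poly_Mapping.single k a) = a *s f k"
  by (cases "a = 0") (auto simp: linear_ext_def)

lemma linear_ext_fun_add:
  "linear_ext scale (\<lambda>k. f k + g k) c = linear_ext scale f c + linear_ext scale g c"
  by (simp add: linear_ext_def scale_right_distrib sum.distrib)

lemma linear_ext_fun_diff:
  "linear_ext scale (\<lambda>k. f k - g k) c = linear_ext scale f c - linear_ext scale g c"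
  by (simp add: linear_ext_def scale_right_diff_distrib sum_subtractf)

lemma linear_ext_in_subspace:
  assumes "subspace B" "\<And>k. k \<in> Poly_Mapping.keys c \<Longrightarrow> f k \<in> B"
  shows "linear_ext scale f c \<in> B"
  unfolding linear_ext_def using assms by (intro subspace_sum subspace_scale)

lemma linear_ext_cong:
  "(\<And>k. k \<in> Poly_Mapping.keys c \<Longrightarrow> f k = g k) \<Longrightarrow> linear_ext scale f c = linear_ext scale g c"
  by (simp add: linear_ext_def)

lemma linear_ext_smult:
  "linear_ext scale f (chain_smult a c) = a *s linear_ext scale f c"
proof -
  have "Poly_Mapping.keys (chain_smult a c) \<subseteq> Poly_Mapping.keys c"
    by (auto simp: in_keys_iff)
  then show ?thesis
    by (simp add: linear_ext_superset [of "Poly_Mapping.keys c"] scale_sum_right)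
qed

end

lemma linear_ext_fun_smult:
  "linear_ext chain_smult (\<lambda>k. chain_smult (f k) K) c = chain_smult (linear_ext (*) f c) K"
  by (simp add: linear_ext_def chain.scale_sum_left)

lemma linear_ext_chain_id: "linear_ext chain_smult (\<lambda>k. Poly_Mapping.single k 1) c = c"
proof (rule poly_mapping_eqI)
  fix k
  show "Poly_Mapping.lookup (linear_ext chain_smult (\<lambda>k. Poly_Mapping.single k 1) c) k
      = Poly_Mapping.lookup c k"
    by (simp add: linear_ext_def lookup_sum lookup_single when_def in_keys_iff
        if_distrib [of "(*) _"] cong: if_cong)
qed

lemma linear_ext_chain_compose:
  assumes "vector_space sc"
  shows "linear_ext sc g (linear_ext chain_smult f c)
      = linear_ext sc (\<lambda>k. linear_ext sc g (f k)) c"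
proof -
  interpret vector_space sc by fact
  show ?thesis
    by (simp add: linear_ext_def [of chain_smult] linear_ext_sum linear_ext_smult)
      (simp add: linear_ext_def)
qed

section \<open>Chains, cycles and boundaries as subspaces\<close>

lemma field_boundary_eq_linear_ext:
  "field_boundary (Suc p) c =
    linear_ext chain_smult
      (\<lambda>\<sigma>. \<Sum>k\<le>Suc p. Poly_Mapping.single (singular_face (Suc p) k \<sigma>) ((- 1) ^ k)) c"
  by (simp add: field_boundary_def linear_ext_def chain.scale_sum_right chain_smult_single
      mult.commute del: sum.atMost_Suc)

lemma field_boundary_add: "field_boundary p (c + d) = field_boundary p c + field_boundary p d"
  by (cases p) (simp_all add: field_boundary_def [of 0] field_boundary_eq_linear_ext chain.linear_ext_add)

lemma field_boundary_smult: "field_boundary p (chain_smult a c) = chain_smult a (field_boundary p c)"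
  by (cases p) (simp_all add: field_boundary_def [of 0] field_boundary_eq_linear_ext chain.linear_ext_smult)

lemma field_boundary_0 [simp]: "field_boundary p 0 = 0"
  by (simp add: field_boundary_def)

lemma subspace_field_chains: "chain.subspace (field_chains p X)"
proof (rule chain.subspaceI)
  show "0 \<in> field_chains p X"
    by (simp add: field_chains_def)
  show "c + d \<in> field_chains p X" if "c \<in> field_chains p X" "d \<in> field_chains p X" for c d
    using that keys_add [of c d] by (auto simp: field_chains_def)
  show "chain_smult a c \<in> field_chains p X" if "c \<in> field_chains p X" for a c
    using that by (force simp: field_chains_def in_keys_iff)
qed

lemma subspace_field_cycles: "chain.subspace (field_cycles p X)"
  using subspace_field_chains [of p X]
  by (auto simp: chain.subspace_def field_cycles_def field_boundary_add field_boundary_smult)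

lemma subspace_field_boundaries: "chain.subspace (field_boundaries p X)"
proof (rule chain.subspaceI)
  note sub = subspace_field_chains [of "Suc p" X]
  show "0 \<in> field_boundaries p X"
    unfolding field_boundaries_def using chain.subspace_0 [OF sub]
    by (intro image_eqI [of _ _ 0]) auto
  show "c + d \<in> field_boundaries p X" if "c \<in> field_boundaries p X" "d \<in> field_boundaries p X" for c d
    using that chain.subspace_add [OF sub]
    by (auto simp: field_boundaries_def intro!: imageI simp flip: field_boundary_add)
  show "chain_smult a c \<in> field_boundaries p X" if "c \<in> field_boundaries p X" for a c
    using that chain.subspace_scale [OF sub]
    by (auto simp: field_boundaries_def intro!: imageI simp flip: field_boundary_smult)
qed

lemma field_chains_mono: "X = subtopology Y S \<Longrightarrow> field_chains p X \<subseteq> field_chains p Y"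
  by (auto simp: field_chains_def singular_simplex_subtopology)

lemma field_cycles_mono: "X = subtopology Y S \<Longrightarrow> field_cycles p X \<subseteq> field_cycles p Y"
  using field_chains_mono by (fastforce simp: field_cycles_def)

lemma field_boundaries_mono: "X = subtopology Y S \<Longrightarrow> field_boundaries p X \<subseteq> field_boundaries p Y"
  using field_chains_mono by (fastforce simp: field_boundaries_def)

section \<open>Homology classes computed on representatives\<close>

lemma mem_homology_class: "d \<in> homology_class p X c \<longleftrightarrow> d - c \<in> field_boundaries p X"
proof -
  have "d = c + b \<longleftrightarrow> b = d - c" for b
    by auto
  then show ?thesis
    by (auto simp: homology_class_def image_iff)
qed

lemma self_mem_homology_class: "c \<in> homology_class p X c"
  by (simp add: mem_homology_class chain.subspace_0 [OF subspace_field_boundaries])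

lemma homology_class_eq_iff:
  "homology_class p X c = homology_class p X d \<longleftrightarrow> c - d \<in> field_boundaries p X"
proof
  assume "homology_class p X c = homology_class p X d"
  then show "c - d \<in> field_boundaries p X"
    using self_mem_homology_class [of c p X] by (simp add: mem_homology_class)
next
  note sub = subspace_field_boundaries [of p X]
  assume cd: "c - d \<in> field_boundaries p X"
  have "b - c \<in> field_boundaries p X \<longleftrightarrow> b - d \<in> field_boundaries p X" for b
    using chain.subspace_add [OF sub _ cd, of "b - c"] chain.subspace_diff [OF sub _ cd, of "b - d"]
    by auto
  then show "homology_class p X c = homology_class p X d"
    by (auto simp: mem_homology_class)
qed

text \<open>Other representatives change the sum by a boundary only, so all cosets in the union
  coincide, and the union is not empty.\<close>

lemma field_homology_add:
  "homology_class p X c \<oplus>\<^bsub>field_homology p X\<^esub> homology_class p X d = homology_class p X (c + d)"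
proof -
  have "homology_class p X (a + b) = homology_class p X (c + d)"
    if "a \<in> homology_class p X c" "b \<in> homology_class p X d" for a b
    using that chain.subspace_add [OF subspace_field_boundaries [of p X], of "a - c" "b - d"]
    by (simp add: mem_homology_class homology_class_eq_iff algebra_simps)
  then have "(\<Union>a\<in>homology_class p X c. \<Union>b\<in>homology_class p X d. homology_class p X (a + b))
      = (\<Union>a\<in>homology_class p X c. \<Union>b\<in>homology_class p X d. homology_class p X (c + d))"
    by (intro SUP_cong refl)
  also have "\<dots> = homology_class p X (c + d)"
    using self_mem_homology_class by auto
  finally show ?thesis
    by (simp add: field_homology_def)
qed

lemma field_homology_smult:
  "a \<odot>\<^bsub>field_homology p X\<^esub> homology_class p X c = homology_class p X (chain_smult a c)"
proof -
  have "homology_class p X (chain_smult a b) = homology_class p X (chain_smult a c)"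
    if "b \<in> homology_class p X c" for b
    using that chain.subspace_scale [OF subspace_field_boundaries [of p X], of "b - c" a]
    by (simp add: mem_homology_class homology_class_eq_iff chain.scale_right_diff_distrib)
  then have "(\<Union>b\<in>homology_class p X c. homology_class p X (chain_smult a b))
      = (\<Union>b\<in>homology_class p X c. homology_class p X (chain_smult a c))"
    by (intro SUP_cong refl)
  also have "\<dots> = homology_class p X (chain_smult a c)"
    using self_mem_homology_class by auto
  finally show ?thesis
    by (simp add: field_homology_def)
qed

lemma carrier_field_homology: "carrier (field_homology p X) = homology_class p X ` field_cycles p X"
  by (simp add: field_homology_def)

lemma zero_field_homology: "\<zero>\<^bsub>field_homology p X\<^esub> = homology_class p X 0"
  by (simp add: field_homology_def)

lemma cring_scalar_field: "cring (scalar_field :: 'f::field ring)"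
proof (intro cringI abelian_groupI comm_monoidI)
  show "\<exists>y\<in>carrier scalar_field. y \<oplus>\<^bsub>scalar_field\<^esub> x = \<zero>\<^bsub>scalar_field\<^esub>" for x :: 'f
    by (rule bexI [of _ "- x"]) (simp_all add: scalar_field_def)
qed (auto simp: scalar_field_def algebra_simps)

lemma vector_space_field_homology:
  "vector_space_over_field (field_homology p X :: ('f::field, ('a, 'f) field_chain set) module)"
proof (intro moduleI cring_scalar_field abelian_groupI)
  let ?H = "field_homology p X :: ('f, ('a, 'f) field_chain set) module"
  note simps = carrier_field_homology field_homology_add field_homology_smult zero_field_homology
    scalar_field_def
  note closed = chain.subspace_0 [OF subspace_field_cycles] chain.subspace_add [OF subspace_field_cycles]
    chain.subspace_scale [OF subspace_field_cycles] chain.subspace_neg [OF subspace_field_cycles]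
  show "\<exists>y\<in>carrier ?H. y \<oplus>\<^bsub>?H\<^esub> x = \<zero>\<^bsub>?H\<^esub>" if "x \<in> carrier ?H" for x
  proof -
    obtain c where c: "c \<in> field_cycles p X" "x = homology_class p X c"
      using \<open>x \<in> carrier ?H\<close> by (auto simp: simps)
    then show ?thesis
      by (intro bexI [of _ "homology_class p X (- c)"]) (auto simp: simps closed)
  qed
  show "x \<oplus>\<^bsub>?H\<^esub> y \<in> carrier ?H" if "x \<in> carrier ?H" "y \<in> carrier ?H" for x y
    using that by (auto simp: simps closed)
  show "a \<odot>\<^bsub>?H\<^esub> x \<in> carrier ?H" if "x \<in> carrier ?H" for x a
    using that by (auto simp: simps closed)
  show "\<zero>\<^bsub>?H\<^esub> \<in> carrier ?H"
    by (auto simp: simps closed)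
qed (auto simp: carrier_field_homology field_homology_add field_homology_smult zero_field_homology
    scalar_field_def algebra_simps chain.scale_left_distrib chain.scale_right_distrib)

text \<open>Singular simplices are extensional, so composing with the identity and restricting again
  returns the very same function.\<close>

lemma field_chain_map_inclusion:
  assumes "c \<in> field_chains p X"
  shows "field_chain_map p (\<lambda>x. x) c = c"
proof -
  have "simplex_map p (\<lambda>x. x) \<sigma> = \<sigma>" if "\<sigma> \<in> Poly_Mapping.keys c" for \<sigma>
    using that assms
    by (auto simp: simplex_map_def field_chains_def singular_simplex_def extensional_restrict
        comp_def dest!: subsetD)
  then have "field_chain_map p (\<lambda>x. x) c = linear_ext chain_smult (\<lambda>k. Poly_Mapping.single k 1) c"
    by (simp add: field_chain_map_def linear_ext_def chain_smult_single)
  then show ?thesis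
    by (simp add: linear_ext_chain_id)
qed

text \<open>The induced map ranges over all representatives of a class; this ensures that each of
  them is a chain of the smaller space, where \<open>field_chain_map_inclusion\<close>
  applies.\<close>

lemma field_boundaries_subset_chains: "field_boundaries p X \<subseteq> field_chains p X"
proof
  fix b
  assume "b \<in> field_boundaries p X"
  then obtain c where c: "c \<in> field_chains (Suc p) X" and b: "b = field_boundary (Suc p) c"
    by (auto simp: field_boundaries_def)
  have "Poly_Mapping.single (singular_face (Suc p) k \<sigma>) a \<in> field_chains p X"
    if "\<sigma> \<in> Poly_Mapping.keys c" "k \<le> Suc p" for \<sigma> k a
    using that c singular_simplex_singular_face [of "Suc p" X \<sigma> k]
    by (auto simp: field_chains_def dest!: subsetD)
  then show "b \<in> field_chains p X"
    unfolding b field_boundary_eq_linear_ext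
    by (intro chain.linear_ext_in_subspace subspace_field_chains chain.subspace_sum) auto
qed

lemma field_hom_induced_inclusion:
  assumes "X = subtopology Y S" "c \<in> field_chains p X"
  shows "field_hom_induced p Y (\<lambda>x. x) (homology_class p X c)
    = homology_class p Y c"
proof -
  have "homology_class p Y (field_chain_map p (\<lambda>x. x) a) = homology_class p Y c"
    if a: "a \<in> homology_class p X c" for a
  proof -
    have ac: "a - c \<in> field_boundaries p X"
      using a by (simp add: mem_homology_class)
    then have "a \<in> field_chains p X"
      using chain.subspace_add [OF subspace_field_chains, of "a - c" p X c]
        field_boundaries_subset_chains assms(2) by auto
    then show ?thesis
      using ac field_boundaries_mono [OF assms(1), of p]
      by (auto simp: field_chain_map_inclusion homology_class_eq_iff)
  qed
  then have "field_hom_induced p Y (\<lambda>x. x) (homology_class p X c)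
      = (\<Union>a\<in>homology_class p X c. homology_class p Y c)"
    unfolding field_hom_induced_def by (intro SUP_cong refl)
  also have "\<dots> = homology_class p Y c"
    using self_mem_homology_class by auto
  finally show ?thesis .
qed

section \<open>Singular simplices of dimension one and two\<close>

lemma singular_simplex_top_of_set:
  "singular_simplex p (top_of_set S) f \<longleftrightarrow>
    continuous_on (standard_simplex p) f \<and> f ` standard_simplex p \<subseteq> S \<and>
    f \<in> extensional (standard_simplex p)"
  by (auto simp: singular_simplex_def euclidean_product_topology continuous_map_in_subtopology)

text \<open>The coordinate \<open>x 1\<close> is the time, so the path runs from vertex
  \<open>0\<close> to vertex \<open>1\<close>.\<close>

definition path_simplex :: "(real \<Rightarrow> 'a) \<Rightarrow> (nat \<Rightarrow> real) \<Rightarrow> 'a" where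
  "path_simplex p = restrict (\<lambda>x. p (x 1)) (standard_simplex 1)"

text \<open>One formula serves two dimensions: \<open>b = 0\<close> gives the 1-simplex.\<close>

definition barycentric :: "real \<Rightarrow> real \<Rightarrow> nat \<Rightarrow> real" where
  "barycentric a b = (\<lambda>i. if i = 0 then 1 - a - b else if i = 1 then a else if i = 2 then b else 0)"

definition simplex_path :: "((nat \<Rightarrow> real) \<Rightarrow> 'a) \<Rightarrow> real \<Rightarrow> 'a" where
  "simplex_path \<sigma> s = \<sigma> (barycentric s 0)"

lemma sum_atMost_2: "(\<Sum>i\<le>2. f i) = f 0 + f 1 + f 2" for f :: "nat \<Rightarrow> 'a::comm_monoid_add"
  by (simp add: numeral_2_eq_2)

lemma barycentric_in_simplex_1: "s \<in> {0..1} \<Longrightarrow> barycentric s 0 \<in> standard_simplex 1"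
  by (auto simp: standard_simplex_def barycentric_def)

lemma barycentric_in_simplex_2:
  "0 \<le> a \<Longrightarrow> 0 \<le> b \<Longrightarrow> a + b \<le> 1 \<Longrightarrow> barycentric a b \<in> standard_simplex 2"
  by (auto simp: standard_simplex_def barycentric_def sum_atMost_2)

lemma simplex_1_eq_barycentric:
  assumes "x \<in> standard_simplex 1"
  shows "x = barycentric (x 1) 0"
proof
  fix i :: nat
  consider "i = 0" | "i = 1" | "i > 1" by linarith
  then show "x i = barycentric (x 1) 0 i"
    using assms by cases (auto simp: standard_simplex_def barycentric_def)
qed

lemma simplex_path_path_simplex: "s \<in> {0..1} \<Longrightarrow> simplex_path (path_simplex p) s = p s"
  using barycentric_in_simplex_1 by (simp add: simplex_path_def path_simplex_def barycentric_def)

lemma path_simplex_simplex_path: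
  assumes "\<sigma> \<in> extensional (standard_simplex 1)"
  shows "path_simplex (simplex_path \<sigma>) = \<sigma>"
proof
  fix x
  show "path_simplex (simplex_path \<sigma>) x = \<sigma> x"
    using assms simplex_1_eq_barycentric [of x]
    by (cases "x \<in> standard_simplex 1") (auto simp: path_simplex_def simplex_path_def extensional_def)
qed

lemma continuous_on_barycentric:
  assumes "continuous_on U f" "continuous_on U g"
  shows "continuous_on U (\<lambda>x. barycentric (f x) (g x))"
  unfolding barycentric_def
proof (rule continuous_on_coordinatewise_then_product)
  fix i :: nat
  show "continuous_on U (\<lambda>x. if i = 0 then 1 - f x - g x else if i = 1 then f x else if i = 2 then g x else 0)"
    by (cases "i = 0"; cases "i = 1"; cases "i = 2") (auto intro!: continuous_intros assms)
qed

lemma continuous_on_simplex_path: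
  assumes "singular_simplex 1 (top_of_set S) \<sigma>"
  shows "continuous_on {0..1} (simplex_path \<sigma>)" "simplex_path \<sigma> ` {0..1} \<subseteq> S"
proof -
  have bary: "continuous_on {0..1::real} (\<lambda>s. barycentric s 0)"
    by (intro continuous_on_barycentric continuous_intros)
  have "continuous_on {0..1} (\<lambda>s. \<sigma> (barycentric s 0))"
    by (rule continuous_on_compose2 [OF _ bary, of "standard_simplex 1"])
      (use assms barycentric_in_simplex_1 in \<open>auto simp: singular_simplex_top_of_set\<close>)
  then show "continuous_on {0..1} (simplex_path \<sigma>)"
    by (simp add: simplex_path_def [abs_def])
  show "simplex_path \<sigma> ` {0..1} \<subseteq> S"
    using assms barycentric_in_simplex_1 by (fastforce simp: singular_simplex_top_of_set simplex_path_def)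
qed

section \<open>Triangles and squares as sources of boundaries\<close>

definition std_triangle :: "(real \<times> real) set" where
  "std_triangle = {(a, b). 0 \<le> a \<and> 0 \<le> b \<and> a + b \<le> 1}"

lemma convex_std_triangle: "convex std_triangle"
proof -
  have eq: "std_triangle = {z. (1, 0) \<bullet> z \<ge> 0} \<inter> {z. (0, 1) \<bullet> z \<ge> 0} \<inter> {z. (1, 1) \<bullet> z \<le> 1}"
    by (auto simp: std_triangle_def)
  show ?thesis
    unfolding eq by (intro convex_Int convex_halfspace_le convex_halfspace_ge)
qed

definition path_chain :: "(real \<Rightarrow> 'a) \<Rightarrow> ('a, 'f::field) field_chain" where
  "path_chain p = Poly_Mapping.single (path_simplex p) 1"

lemma path_chain_simplex_path:
  "singular_simplex p X \<sigma> \<Longrightarrow> p = 1 \<Longrightarrow> path_chain (simplex_path \<sigma>) = Poly_Mapping.single \<sigma> 1"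
  by (simp add: path_chain_def path_simplex_simplex_path singular_simplex_def)

lemma singular_simplex_path_simplex:
  assumes "continuous_on {0..1} p" "p ` {0..1} \<subseteq> S"
  shows "singular_simplex 1 (top_of_set S) (path_simplex p)"
proof -
  have 01: "x 1 \<in> {0..1}" if "x \<in> standard_simplex 1" for x :: "nat \<Rightarrow> real"
    using that by (auto simp: standard_simplex_def)
  have "continuous_on (standard_simplex 1) (\<lambda>x. p (x 1))"
    by (rule continuous_on_compose2 [OF assms(1)])
      (use 01 in \<open>auto intro!: continuous_on_product_coordinates [THEN continuous_on_subset]\<close>)
  then have "continuous_on (standard_simplex 1) (path_simplex p)"
    by (rule continuous_on_eq) (auto simp: path_simplex_def)
  then show ?thesis
    using assms(2) 01 by (fastforce simp: singular_simplex_top_of_set path_simplex_def)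
qed

lemma single_in_field_chains:
  "singular_simplex p X \<sigma> \<Longrightarrow> Poly_Mapping.single \<sigma> a \<in> field_chains p X"
  by (simp add: field_chains_def)

lemma field_boundary_single:
  "field_boundary (Suc p) (Poly_Mapping.single \<sigma> a) =
    (\<Sum>k\<le>Suc p. Poly_Mapping.single (singular_face (Suc p) k \<sigma>) ((- 1) ^ k * a))"
  by (simp add: field_boundary_eq_linear_ext chain.scale_sum_right chain_smult_single
      mult.commute del: sum.atMost_Suc)

text \<open>In the coordinates \<open>(x 1, x 2)\<close> the faces opposite to the vertices
  \<open>0\<close>, \<open>1\<close>, \<open>2\<close> run from \<open>(1, 0)\<close> to
  \<open>(0, 1)\<close>, from \<open>(0, 0)\<close> to \<open>(0, 1)\<close> and from
  \<open>(0, 0)\<close> to \<open>(1, 0)\<close>, with alternating signs.\<close>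

lemma triangle_boundary:
  assumes f: "continuous_on std_triangle f" "f ` std_triangle \<subseteq> S"
  shows "path_chain (\<lambda>s. f (1 - s, s)) - path_chain (\<lambda>s. f (0, s)) + path_chain (\<lambda>s. f (s, 0))
    \<in> (field_boundaries 1 (top_of_set S) :: ('a::topological_space, 'f::field) field_chain set)"
proof -
  define \<sigma> where "\<sigma> = restrict (\<lambda>x. f (x 1, x 2)) (standard_simplex 2)"
  have tri: "(x 1, x 2) \<in> std_triangle" if "x \<in> standard_simplex 2" for x :: "nat \<Rightarrow> real"
    using that by (simp add: standard_simplex_def std_triangle_def sum_atMost_2) (smt (verit))
  have "continuous_on (standard_simplex 2) (\<lambda>x. f (x 1, x 2))"
    by (rule continuous_on_compose2 [OF f(1)])
      (use tri in \<open>auto intro!: continuous_intros continuous_on_product_coordinates [THEN continuous_on_subset]\<close>)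
  then have "continuous_on (standard_simplex 2) \<sigma>"
    by (rule continuous_on_eq) (auto simp: \<sigma>_def)
  then have sing: "singular_simplex 2 (top_of_set S) \<sigma>"
    using f(2) tri by (auto simp: singular_simplex_top_of_set \<sigma>_def)
  have face_in: "simplical_face k x \<in> standard_simplex 2" if "k \<le> 2" "x \<in> standard_simplex 1" for k and x :: "nat \<Rightarrow> real"
    using that simplical_face_in_standard_simplex [of 2 k x] by simp
  have sum1: "x 0 = 1 - x 1" if "x \<in> standard_simplex 1" for x :: "nat \<Rightarrow> real"
    using that by (simp add: standard_simplex_def)
  have "singular_face 2 0 \<sigma> = path_simplex (\<lambda>s. f (1 - s, s))"
       "singular_face 2 1 \<sigma> = path_simplex (\<lambda>s. f (0, s))"
       "singular_face 2 2 \<sigma> = path_simplex (\<lambda>s. f (s, 0))"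
    unfolding singular_face_def path_simplex_def \<sigma>_def
    by (auto intro!: restrict_ext simp: face_in, auto simp: simplical_face_def sum1)
  then have "field_boundary 2 (Poly_Mapping.single \<sigma> (1::'f))
      = path_chain (\<lambda>s. f (1 - s, s)) - path_chain (\<lambda>s. f (0, s)) + path_chain (\<lambda>s. f (s, 0))"
    using field_boundary_single [of 1 \<sigma> "1::'f"]
    by (simp add: numeral_2_eq_2 path_chain_def single_uminus)
  then show ?thesis
    unfolding field_boundaries_def
    by (intro image_eqI [of _ _ "Poly_Mapping.single \<sigma> 1"])
      (use sing in \<open>auto simp: numeral_2_eq_2 intro: single_in_field_chains\<close>)
qed

text \<open>The diagonal cuts the square into two triangles, parametrized by \<open>?f\<close> and
  \<open>?g\<close>. It is a face of the same sign in both, so it cancels in the difference of their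
  boundaries.\<close>

lemma square_boundary:
  fixes k :: "real \<times> real \<Rightarrow> 'a::topological_space"
  assumes k: "continuous_on ({0..1} \<times> {0..1}) k" "k ` ({0..1} \<times> {0..1}) \<subseteq> S"
  shows "path_chain (\<lambda>s. k (s, 0)) + path_chain (\<lambda>s. k (1, s))
    - path_chain (\<lambda>s. k (0, s)) - path_chain (\<lambda>s. k (s, 1))
    \<in> (field_boundaries 1 (top_of_set S) :: ('a, 'f::field) field_chain set)"
proof -
  let ?f = "\<lambda>z. k (fst z + snd z, snd z)" and ?g = "\<lambda>z. k (snd z, fst z + snd z)"
  have "continuous_on std_triangle ?f" "continuous_on std_triangle ?g"
    by (rule continuous_on_compose2 [OF k(1)]; force simp: std_triangle_def intro!: continuous_intros)+
  moreover have "?f ` std_triangle \<subseteq> S" "?g ` std_triangle \<subseteq> S"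
    using k(2) by (force simp: std_triangle_def)+
  ultimately have "path_chain (\<lambda>s. k (1, s)) - path_chain (\<lambda>s. k (s, s)) + path_chain (\<lambda>s. k (s, 0))
      \<in> (field_boundaries 1 (top_of_set S) :: ('a, 'f) field_chain set)"
    "path_chain (\<lambda>s. k (s, 1)) - path_chain (\<lambda>s. k (s, s)) + path_chain (\<lambda>s. k (0, s))
      \<in> (field_boundaries 1 (top_of_set S) :: ('a, 'f) field_chain set)"
    using triangle_boundary [of ?f S] triangle_boundary [of ?g S] by simp_all
  from chain.subspace_diff [OF subspace_field_boundaries this] show ?thesis
    by (simp add: algebra_simps)
qed

text \<open>A constant triangle has three equal faces, with signs 1, -1, 1.\<close>

lemma const_path_boundary:
  assumes "x \<in> S"
  shows "path_chain (\<lambda>_. x) \<in> field_boundaries 1 (top_of_set S)"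
  using triangle_boundary [of "\<lambda>_. x" S] assms by (auto intro: continuous_intros)

text \<open>The terms \<open>T\<close> telescope because the boundary of the cycle vanishes.\<close>

lemma cycle_homologous_multiple:
  assumes c: "c \<in> field_cycles 1 X"
    and T: "\<And>\<sigma>. singular_simplex 1 X \<sigma> \<Longrightarrow>
      Poly_Mapping.single \<sigma> 1 - (T (simplex_path \<sigma> 1) - T (simplex_path \<sigma> 0) + chain_smult (N \<sigma>) K)
        \<in> field_boundaries 1 X"
  shows "c - chain_smult (linear_ext (*) N c) K \<in> field_boundaries 1 X"
proof -
  \<comment> \<open>The only point of the 0-simplex; evaluation there turns 0-simplices into points
    of the space.\<close>
  let ?v = "\<lambda>j::nat. if j = 0 then 1 else 0 :: real"
  have v: "?v \<in> standard_simplex 0"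
    by simp
  have sf: "simplical_face 0 ?v = barycentric 1 0" "simplical_face 1 ?v = barycentric 0 0"
    by (auto simp: simplical_face_def barycentric_def fun_eq_iff)
  have face: "singular_face 1 0 \<sigma> ?v = simplex_path \<sigma> 1" "singular_face 1 1 \<sigma> ?v = simplex_path \<sigma> 0"
    for \<sigma> :: "(nat \<Rightarrow> real) \<Rightarrow> 'a"
    using v sf by (simp_all add: singular_face_def simplex_path_def)
  have "linear_ext chain_smult (\<lambda>\<rho>. T (\<rho> ?v)) (field_boundary 1 c)
      = linear_ext chain_smult (\<lambda>\<sigma>. T (simplex_path \<sigma> 1) - T (simplex_path \<sigma> 0)) c"
    using field_boundary_eq_linear_ext [of 0 c] face
    by (simp add: linear_ext_chain_compose [OF chain.vector_space_axioms] chain.linear_ext_add)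
  moreover have "field_boundary 1 c = 0"
    using c by (simp add: field_cycles_def)
  ultimately have tele: "linear_ext chain_smult (\<lambda>\<sigma>. T (simplex_path \<sigma> 1) - T (simplex_path \<sigma> 0)) c = 0"
    by simp
  have "linear_ext chain_smult (\<lambda>\<sigma>. Poly_Mapping.single \<sigma> 1 -
      (T (simplex_path \<sigma> 1) - T (simplex_path \<sigma> 0) + chain_smult (N \<sigma>) K)) c \<in> field_boundaries 1 X"
    using c T by (intro chain.linear_ext_in_subspace subspace_field_boundaries)
      (auto simp: field_cycles_def field_chains_def)
  also have "linear_ext chain_smult (\<lambda>\<sigma>. Poly_Mapping.single \<sigma> 1 -
      (T (simplex_path \<sigma> 1) - T (simplex_path \<sigma> 0) + chain_smult (N \<sigma>) K)) c
    = linear_ext chain_smult (\<lambda>\<sigma>. Poly_Mapping.single \<sigma> 1) c -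
      (linear_ext chain_smult (\<lambda>\<sigma>. T (simplex_path \<sigma> 1) - T (simplex_path \<sigma> 0)) c
        + linear_ext chain_smult (\<lambda>\<sigma>. chain_smult (N \<sigma>) K) c)"
    by (subst chain.linear_ext_fun_diff, subst chain.linear_ext_fun_add) (rule refl)
  also have "\<dots> = c - chain_smult (linear_ext (*) N c) K"
    by (simp only: tele linear_ext_chain_id linear_ext_fun_smult add_0)
  finally show ?thesis .
qed

text \<open>Both faces are the same 0-simplex and enter the boundary with opposite signs.\<close>

lemma path_chain_cycle:
  assumes "continuous_on {0..1} p" "p ` {0..1} \<subseteq> S" "p 0 = p 1"
  shows "path_chain p \<in> (field_cycles 1 (top_of_set S) :: ('a::topological_space, 'f::field) field_chain set)"
proof -
  have "singular_face 1 0 (path_simplex p) = singular_face 1 1 (path_simplex p)"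
  proof -
    have "(path_simplex p \<circ> simplical_face 0) x = (path_simplex p \<circ> simplical_face 1) x"
      if x: "x \<in> standard_simplex 0" for x
    proof -
      have "simplical_face 0 x = barycentric 1 0" "simplical_face 1 x = barycentric 0 0"
        using x by (auto simp: standard_simplex_0 simplical_face_def barycentric_def fun_eq_iff)
      then show ?thesis
        using assms(3) simplex_path_path_simplex [of 0 p] simplex_path_path_simplex [of 1 p]
        by (simp add: simplex_path_def)
    qed
    then show ?thesis
      by (auto simp: singular_face_def intro!: restrict_ext)
  qed
  then have "field_boundary 1 (path_chain p :: ('a, 'f) field_chain) = 0"
    using field_boundary_single [of 0 "path_simplex p" "1::'f"]
    by (simp add: path_chain_def flip: single_add)
  then show ?thesis
    using singular_simplex_path_simplex [OF assms(1,2)]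
    by (simp add: field_cycles_def path_chain_def single_in_field_chains)
qed

section \<open>Winding numbers and subsets of the circle\<close>

text \<open>The difference of the two logarithms takes values in a set whose points are at least
  \<open>2 * pi\<close> apart, so it is constant on the connected interval.\<close>

lemma continuous_logarithm_increment_unique:
  assumes "continuous_on {0..1::real} h" "continuous_on {0..1} h'"
    and "\<And>s. s \<in> {0..1} \<Longrightarrow> exp (h s) = exp (h' s :: complex)"
  shows "h 1 - h 0 = h' 1 - h' 0"
proof -
  have "(\<lambda>s. h s - h' s) constant_on {0..1}"
  proof (rule continuous_discrete_range_constant)
    show "continuous_on {0..1} (\<lambda>s. h s - h' s)"
      by (intro continuous_intros assms)
    fix x :: real
    assume x: "x \<in> {0..1}"
    have "2 * pi \<le> cmod ((h y - h' y) - (h x - h' x))"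
      if y: "y \<in> {0..1}" "h y - h' y \<noteq> h x - h' x" for y
    proof -
      define w where "w = (h y - h' y) - (h x - h' x)"
      have "exp w = 1"
        using assms(3) [OF x] assms(3) [OF y(1)] by (simp add: w_def exp_diff)
      then obtain n :: int where n: "Re w = 0" "Im w = of_int (2 * n) * pi"
        by (auto simp: exp_eq_1)
      have "w \<noteq> 0"
        using y(2) by (simp add: w_def)
      then have "n \<noteq> 0"
        using n by (auto simp: complex_eq_iff)
      then have "1 \<le> \<bar>real_of_int n\<bar>"
        by linarith
      then have "2 * pi * 1 \<le> 2 * pi * \<bar>real_of_int n\<bar>"
        by (intro mult_left_mono) auto
      also have "\<dots> = \<bar>Im w\<bar>"
        by (simp add: n abs_mult)
      also have "\<dots> \<le> cmod w"
        by (rule abs_Im_le_cmod)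
      finally show ?thesis
        by (simp add: w_def)
    qed
    then show "\<exists>e>0. \<forall>y. y \<in> {0..1} \<and> h y - h' y \<noteq> h x - h' x \<longrightarrow>
        e \<le> norm ((h y - h' y) - (h x - h' x))"
      by (intro exI [of _ "2 * pi"]) auto
  qed simp
  then obtain d where "\<And>s. s \<in> {0..1} \<Longrightarrow> h s - h' s = d"
    by (auto simp: constant_on_def)
  from this [of 0] this [of 1] show ?thesis
    by (simp add: algebra_simps)
qed

text \<open>The total change of the argument along \<open>q\<close>. The description is meaningful
  only for paths that have a continuous logarithm, in particular no zeros.\<close>

definition arg_increment :: "(real \<Rightarrow> complex) \<Rightarrow> real" where
  "arg_increment q = (THE d. \<exists>h. continuous_on {0..1} h \<and> (\<forall>s\<in>{0..1}. q s = exp (h s)) \<and>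
    d = Im (h 1) - Im (h 0))"

lemma arg_increment_eq:
  assumes "continuous_on {0..1} h" "\<And>s. s \<in> {0..1} \<Longrightarrow> q s = exp (h s)"
  shows "arg_increment q = Im (h 1) - Im (h 0)"
  unfolding arg_increment_def
proof (rule the_equality)
  show "\<exists>h'. continuous_on {0..1} h' \<and> (\<forall>s\<in>{0..1}. q s = exp (h' s)) \<and>
      Im (h 1) - Im (h 0) = Im (h' 1) - Im (h' 0)"
    using assms by blast
  fix d
  assume "\<exists>h'. continuous_on {0..1} h' \<and> (\<forall>s\<in>{0..1}. q s = exp (h' s)) \<and> d = Im (h' 1) - Im (h' 0)"
  then obtain h' where "continuous_on {0..1} h'" "\<forall>s\<in>{0..1}. q s = exp (h' s)" "d = Im (h' 1) - Im (h' 0)"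
    by blast
  then show "d = Im (h 1) - Im (h 0)"
    using continuous_logarithm_increment_unique [of h h'] assms by (metis minus_complex.sel(2))
qed

text \<open>For paths that are not closed, the angle between the endpoints is measured by \<open>Arg\<close>.\<close>

definition path_winding :: "(real \<Rightarrow> complex) \<Rightarrow> int" where
  "path_winding q = \<lfloor>(arg_increment q - (Arg (q 1) - Arg (q 0))) / (2 * pi)\<rfloor>"

lemma Im_log_eq_Arg:
  assumes "z = exp w"
  shows "\<exists>n::int. Im w = Arg z + 2 * pi * n"
proof -
  have "z \<noteq> 0"
    using assms by simp
  then have "exp (w - Ln z) = 1"
    using assms by (simp add: exp_diff)
  then obtain n :: int where "Im (w - Ln z) = of_int (2 * n) * pi"
    by (auto simp: exp_eq_1)
  then show ?thesis
    using \<open>z \<noteq> 0\<close> by (intro exI [of _ n]) (simp add: Arg_eq_Im_Ln algebra_simps)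
qed

text \<open>At each end the imaginary part of the logarithm is \<open>Arg\<close> up to a multiple
  of \<open>2 * pi\<close>, so the quotient inside the floor is already an integer.\<close>

lemma path_winding_eq:
  assumes h: "continuous_on {0..1} h" "\<And>s. s \<in> {0..1} \<Longrightarrow> q s = exp (h s)"
  shows "2 * pi * path_winding q = (Im (h 1) - Im (h 0)) - (Arg (q 1) - Arg (q 0))"
proof -
  obtain n1 n0 :: int where n: "Im (h 1) = Arg (q 1) + 2 * pi * n1" "Im (h 0) = Arg (q 0) + 2 * pi * n0"
    using Im_log_eq_Arg [OF h(2), of 1] Im_log_eq_Arg [OF h(2), of 0] by auto
  have "(arg_increment q - (Arg (q 1) - Arg (q 0))) / (2 * pi) = of_int (n1 - n0)"
    using arg_increment_eq [OF h] by (simp add: n field_simps)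
  then have pw: "path_winding q = n1 - n0"
    by (simp only: path_winding_def floor_of_int)
  show ?thesis
    unfolding pw n by (simp add: algebra_simps)
qed

text \<open>Winding numbers are integers, sent to the field by \<open>of_int\<close>; a loop that
  winds once has the value \<open>1\<close>, which is nonzero in every characteristic.\<close>

definition winding_functional :: "('a \<Rightarrow> complex) \<Rightarrow> ('a, 'f::field) field_chain \<Rightarrow> 'f" where
  "winding_functional \<Phi> = linear_ext (*) (\<lambda>\<sigma>. of_int (path_winding (\<Phi> \<circ> simplex_path \<sigma>)))"

text \<open>The triangle is contractible, so one logarithm \<open>g\<close> exists on all of it. The
  increments of \<open>Im g\<close> and the differences of \<open>Arg\<close> both telescope around
  the three edges.\<close>

lemma path_winding_triangle:
  assumes \<sigma>: "singular_simplex 2 (top_of_set S) \<sigma>"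
    and \<Phi>: "continuous_on S \<Phi>" "\<And>z. z \<in> S \<Longrightarrow> \<Phi> z \<noteq> 0"
  shows "path_winding (\<Phi> \<circ> simplex_path (singular_face 2 0 \<sigma>))
    - path_winding (\<Phi> \<circ> simplex_path (singular_face 2 1 \<sigma>))
    + path_winding (\<Phi> \<circ> simplex_path (singular_face 2 2 \<sigma>)) = 0"
proof -
  define f where "f = (\<lambda>z. \<Phi> (\<sigma> (barycentric (fst z) (snd z))))"
  have bary: "continuous_on std_triangle (\<lambda>z. barycentric (fst z) (snd z))"
    by (intro continuous_on_barycentric continuous_intros)
  have mem: "barycentric (fst z) (snd z) \<in> standard_simplex 2" if "z \<in> std_triangle" for z
    using that barycentric_in_simplex_2 by (auto simp: std_triangle_def)
  have "continuous_on std_triangle (\<lambda>z. \<sigma> (barycentric (fst z) (snd z)))"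
    by (rule continuous_on_compose2 [OF _ bary, of "standard_simplex 2"])
      (use \<sigma> mem in \<open>auto simp: singular_simplex_top_of_set\<close>)
  then have "continuous_on std_triangle f"
    unfolding f_def using \<sigma> mem
    by (intro continuous_on_compose2 [OF \<Phi>(1)]) (auto simp: singular_simplex_top_of_set)
  moreover have "f z \<noteq> 0" if "z \<in> std_triangle" for z
    using \<Phi>(2) \<sigma> mem [OF that] by (auto simp: f_def singular_simplex_top_of_set)
  ultimately obtain g where g: "continuous_on std_triangle g" "\<And>z. z \<in> std_triangle \<Longrightarrow> f z = exp (g z)"
    using continuous_logarithm_on_contractible [OF _ convex_imp_contractible [OF convex_std_triangle]]
    by blast
  have face: "singular_face 2 0 \<sigma> (barycentric s 0) = \<sigma> (barycentric (1 - s) s)"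
    "singular_face 2 1 \<sigma> (barycentric s 0) = \<sigma> (barycentric 0 s)"
    "singular_face 2 2 \<sigma> (barycentric s 0) = \<sigma> (barycentric s 0)" if "s \<in> {0..1}" for s
  proof -
    have "simplical_face 0 (barycentric s 0) = barycentric (1 - s) s"
      "simplical_face 1 (barycentric s 0) = barycentric 0 s"
      "simplical_face 2 (barycentric s 0) = barycentric s 0"
      by (auto simp: simplical_face_def barycentric_def fun_eq_iff)
    then show "singular_face 2 0 \<sigma> (barycentric s 0) = \<sigma> (barycentric (1 - s) s)"
      "singular_face 2 1 \<sigma> (barycentric s 0) = \<sigma> (barycentric 0 s)"
      "singular_face 2 2 \<sigma> (barycentric s 0) = \<sigma> (barycentric s 0)"
      using barycentric_in_simplex_1 [OF that] by (simp_all add: singular_face_def)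
  qed
  have edge: "2 * pi * path_winding q =
      (Im (g (e 1)) - Im (g (e 0))) - (Arg (f (e 1)) - Arg (f (e 0)))"
    if e: "continuous_on {0..1} e" "e ` {0..1} \<subseteq> std_triangle" "\<And>s. s \<in> {0..1} \<Longrightarrow> q s = f (e s)" for e q
  proof -
    have "continuous_on {0..1} (\<lambda>s. g (e s))"
      using e(2) by (intro continuous_on_compose2 [OF g(1) e(1)])
    then show ?thesis
      using path_winding_eq [of "\<lambda>s. g (e s)" q] e g(2) by (auto simp: image_subset_iff)
  qed
  have "2 * pi * path_winding (\<Phi> \<circ> simplex_path (singular_face 2 0 \<sigma>))
      = (Im (g (0, 1)) - Im (g (1, 0))) - (Arg (f (0, 1)) - Arg (f (1, 0)))"
    by (subst edge [of "\<lambda>s. (1 - s, s)"])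
      (auto intro!: continuous_intros simp: std_triangle_def simplex_path_def face f_def)
  moreover have "2 * pi * path_winding (\<Phi> \<circ> simplex_path (singular_face 2 1 \<sigma>))
      = (Im (g (0, 1)) - Im (g (0, 0))) - (Arg (f (0, 1)) - Arg (f (0, 0)))"
    by (subst edge [of "\<lambda>s. (0, s)"])
      (auto intro!: continuous_intros simp: std_triangle_def simplex_path_def face [simplified] f_def)
  moreover have "2 * pi * path_winding (\<Phi> \<circ> simplex_path (singular_face 2 2 \<sigma>))
      = (Im (g (1, 0)) - Im (g (0, 0))) - (Arg (f (1, 0)) - Arg (f (0, 0)))"
    by (subst edge [of "\<lambda>s. (s, 0)"])
      (auto intro!: continuous_intros simp: std_triangle_def simplex_path_def face f_def)
  ultimately have "2 * pi * (real_of_int (path_winding (\<Phi> \<circ> simplex_path (singular_face 2 0 \<sigma>))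
    - path_winding (\<Phi> \<circ> simplex_path (singular_face 2 1 \<sigma>))
    + path_winding (\<Phi> \<circ> simplex_path (singular_face 2 2 \<sigma>)))) = 0"
    unfolding of_int_add of_int_diff distrib_left right_diff_distrib by linarith
  then show ?thesis
    by (simp only: mult_eq_0_iff of_int_eq_0_iff) simp
qed

lemma winding_functional_boundary:
  assumes c: "c \<in> field_boundaries 1 (top_of_set S)"
    and \<Phi>: "continuous_on S \<Phi>" "\<And>z. z \<in> S \<Longrightarrow> \<Phi> z \<noteq> 0"
  shows "winding_functional \<Phi> c = 0"
proof -
  let ?w = "\<lambda>k \<sigma>. path_winding (\<Phi> \<circ> simplex_path (singular_face 2 k \<sigma>))"
  obtain d where d: "d \<in> field_chains 2 (top_of_set S)" and c: "c = field_boundary 2 d"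
    using c by (auto simp: field_boundaries_def numeral_2_eq_2)
  have "winding_functional \<Phi> c =
      linear_ext (*) (\<lambda>\<sigma>. of_int (?w 0 \<sigma> - ?w 1 \<sigma> + ?w 2 \<sigma>)) d"
    using field_boundary_eq_linear_ext [of 1 d]
    by (simp add: c winding_functional_def numeral_2_eq_2 vector_space_over_itself.linear_ext_add
        linear_ext_chain_compose [OF vector_space_over_itself.vector_space_axioms])
  also have "\<dots> = linear_ext (*) (\<lambda>\<sigma>. 0) d"
  proof (rule vector_space_over_itself.linear_ext_cong)
    fix \<sigma>
    assume "\<sigma> \<in> Poly_Mapping.keys d"
    then have "singular_simplex 2 (top_of_set S) \<sigma>"
      using d by (auto simp: field_chains_def)
    from path_winding_triangle [OF this \<Phi>]
    show "of_int (?w 0 \<sigma> - ?w 1 \<sigma> + ?w 2 \<sigma>) = 0"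
      by (simp only: of_int_0)
  qed
  finally show ?thesis
    by (simp add: linear_ext_def)
qed

text \<open>The straight line homotopy deforms \<open>S\<close> into the image of \<open>G\<close>, and \<open>G\<close> is a function of
  the direction of its argument.\<close>

locale circle_retraction =
  fixes S :: "'a::real_normed_vector set" and \<Phi> :: "'a \<Rightarrow> complex" and G :: "complex \<Rightarrow> 'a"
  assumes cont_\<Phi>: "continuous_on S \<Phi>"
    and \<Phi>_nonzero: "z \<in> S \<Longrightarrow> \<Phi> z \<noteq> 0"
    and cont_G: "continuous_on (- {0}) G"
    and G_scale: "0 < c \<Longrightarrow> G (of_real c * w) = G w"
    and segment_subset: "z \<in> S \<Longrightarrow> closed_segment z (G (\<Phi> z)) \<subseteq> S"
begin

text \<open>The path of a single point under the deformation; it serves as a correction attached to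
  the ends of a path.\<close>

definition track :: "'a \<Rightarrow> ('a, 'f::field) field_chain" where
  "track z = path_chain (\<lambda>s. (1 - s) *\<^sub>R z + s *\<^sub>R G (\<Phi> z))"

text \<open>The ends are real angles and not points of the circle, which distinguishes arcs by their
  number of turns.\<close>

definition arc :: "real \<Rightarrow> real \<Rightarrow> ('a, 'f::field) field_chain" where
  "arc a b = path_chain (\<lambda>s. G (cis ((1 - s) * a + s * b)))"

lemma G_exp: "G (exp w) = G (cis (Im w))"
  using G_scale [of "exp (Re w)" "cis (Im w)"] by (simp add: exp_eq_polar)

lemma continuous_on_G_cis [continuous_intros]:
  "continuous_on U f \<Longrightarrow> continuous_on U (\<lambda>x. G (cis (f x)))"
  by (rule continuous_on_compose2 [OF cont_G]) (auto intro!: continuous_intros)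

lemma convex_real_combination:
  assumes "convex (J :: real set)" "a \<in> J" "b \<in> J" "s \<in> {0..1}"
  shows "(1 - s) * a + s * b \<in> J"
  using assms convexD_alt [of J a b s] by auto

text \<open>Affine combinations of the three angles stay in \<open>J\<close> and span a triangle in
  \<open>S\<close> with the arcs as faces. The set \<open>J\<close> will be \<open>UNIV\<close> when
  the circle is complete, and a component of the allowed angles otherwise.\<close>

lemma arc_triangle:
  assumes J: "convex J" "\<And>t. t \<in> J \<Longrightarrow> G (cis t) \<in> S" and abc: "a \<in> J" "b \<in> J" "c \<in> J"
  shows "arc b c - arc a c + arc a b \<in> (field_boundaries 1 (top_of_set S) :: ('a, 'f::field) field_chain set)"
proof -
  let ?t = "\<lambda>z. (1 - fst z - snd z) * a + fst z * b + snd z * c"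
  have "?t z \<in> J" if z: "z \<in> std_triangle" for z
    using convex_sum [of "{0, 1, 2::nat}" J "\<lambda>i. if i = 0 then 1 - fst z - snd z else if i = 1 then fst z else snd z"
        "\<lambda>i. if i = 0 then a else if i = 1 then b else c"] z J(1) abc
    by (auto simp: std_triangle_def add_ac)
  then have "(\<lambda>z. G (cis (?t z))) ` std_triangle \<subseteq> S"
    using J(2) by auto
  moreover have "continuous_on std_triangle (\<lambda>z. G (cis (?t z)))"
    by (intro continuous_intros)
  ultimately show ?thesis
    using triangle_boundary [of "\<lambda>z. G (cis (?t z))" S] by (simp add: arc_def)
qed

lemma arc_shift: "arc (a + 2 * pi * of_int n) (b + 2 * pi * of_int n) = arc a b"
proof -
  have "cis ((1 - s) * (a + 2 * pi * of_int n) + s * (b + 2 * pi * of_int n))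
      = cis ((1 - s) * a + s * b) * cis (2 * pi * of_int n)" for s
    by (simp add: cis_mult algebra_simps)
  then show ?thesis
    by (simp add: arc_def)
qed

text \<open>Two squares are glued: the straight-line homotopy from \<open>p\<close> to its image on
  the circle, whose sides are the tracks of the ends, and the linear homotopy from the angle
  \<open>Im (h s)\<close> to the interpolation of its end values, whose sides are constant. The
  angles attained by the path form an interval, so the second square stays in \<open>S\<close> even
  if the circle is incomplete; the second claim records this.\<close>

lemma path_homologous_arc:
  assumes p: "continuous_on {0..1} p" "p ` {0..1} \<subseteq> S"
    and h: "continuous_on {0..1} h" "\<And>s. s \<in> {0..1} \<Longrightarrow> \<Phi> (p s) = exp (h s)"
  shows "path_chain p + track (p 1) - track (p 0) - arc (Im (h 0)) (Im (h 1))
      \<in> (field_boundaries 1 (top_of_set S) :: ('a, 'f::field) field_chain set)" (is ?homologous)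
    and "t \<in> closed_segment (Im (h 0)) (Im (h 1)) \<Longrightarrow> G (cis t) \<in> S"
proof -
  let ?B = "field_boundaries 1 (top_of_set S) :: ('a, 'f) field_chain set"
  have Gh: "G (\<Phi> (p s)) = G (cis (Im (h s)))" if "s \<in> {0..1}" for s
    using h(2) [OF that] by (simp add: G_exp)
  have Gp_in: "G (\<Phi> z) \<in> S" if "z \<in> S" for z
    using segment_subset [OF that] by auto
  define J where "J = (\<lambda>s. Im (h s)) ` {0..1}"
  have "connected J"
    unfolding J_def by (intro connected_continuous_image continuous_intros h) auto
  then have J: "convex J" by (simp add: connected_convex_1)
  have JS: "G (cis t) \<in> S" if "t \<in> J" for t
    using that Gh Gp_in p(2) by (fastforce simp: J_def)
  have J01: "Im (h s) \<in> J" if "s \<in> {0..1}" for s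
    using that by (auto simp: J_def)
  show "G (cis t) \<in> S" if "t \<in> closed_segment (Im (h 0)) (Im (h 1))"
    using that JS J01 [of 0] J01 [of 1] closed_segment_subset [OF _ _ J] by auto
  let ?k = "\<lambda>z. (1 - snd z) *\<^sub>R p (fst z) + snd z *\<^sub>R G (cis (Im (h (fst z))))"
  have cp: "continuous_on ({0..1} \<times> {0..1}) (\<lambda>z. p (fst z))" "continuous_on ({0..1} \<times> {0..1}) (\<lambda>z. h (fst z))"
    by (rule continuous_on_compose2 [OF p(1)] continuous_on_compose2 [OF h(1)];
        auto intro!: continuous_intros)+
  have "continuous_on ({0..1} \<times> {0..1}) ?k"
    by (intro continuous_intros cp)
  moreover have "?k ` ({0..1} \<times> {0..1}) \<subseteq> S"
  proof -
    have "(1 - u) *\<^sub>R p s + u *\<^sub>R G (cis (Im (h s))) \<in> S" if "s \<in> {0..1}" "u \<in> {0..1}" for s u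
    proof -
      have "(1 - u) *\<^sub>R p s + u *\<^sub>R G (\<Phi> (p s)) \<in> closed_segment (p s) (G (\<Phi> (p s)))"
        using that(2) by (auto simp: in_segment)
      then show ?thesis
        using segment_subset [of "p s"] p(2) that(1) Gh [OF that(1)] by (auto simp: image_subset_iff)
    qed
    then show ?thesis by auto
  qed
  ultimately have 1: "path_chain p + track (p 1) - track (p 0) - path_chain (\<lambda>s. G (cis (Im (h s)))) \<in> ?B"
    using square_boundary [of ?k S] Gh [of 0] Gh [of 1] by (simp add: track_def)
  let ?m = "\<lambda>z. G (cis ((1 - snd z) * Im (h (fst z)) + snd z * ((1 - fst z) * Im (h 0) + fst z * Im (h 1))))"
  have "continuous_on ({0..1} \<times> {0..1}) ?m"
    by (intro continuous_intros cp)
  moreover have "?m ` ({0..1} \<times> {0..1}) \<subseteq> S"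
    using J J01 by (auto intro!: JS convex_real_combination)
  ultimately have 2: "path_chain (\<lambda>s. G (cis (Im (h s)))) + path_chain (\<lambda>s. G (cis (Im (h 1))))
      - path_chain (\<lambda>s. G (cis (Im (h 0)))) - arc (Im (h 0)) (Im (h 1)) \<in> ?B"
    using square_boundary [of ?m S] by (simp add: arc_def flip: distrib_right)
  have 3: "path_chain (\<lambda>s. G (cis (Im (h 1)))) \<in> ?B" "path_chain (\<lambda>s. G (cis (Im (h 0)))) \<in> ?B"
    using JS J01 by (intro const_path_boundary; simp)+
  note sub = subspace_field_boundaries [of 1 "top_of_set S"]
  from chain.subspace_add [OF sub chain.subspace_diff [OF sub chain.subspace_add [OF sub 1 2] 3(1)] 3(2)]
  show ?homologous
    by (simp add: algebra_simps)
qed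

text \<open>In the triangle on the angles \<open>0\<close>, \<open>2 * pi\<close> and
  \<open>u + 2 * pi\<close>, the arc starting at \<open>2 * pi\<close> is a shift of the arc from
  \<open>0\<close> to \<open>u\<close>; so one more turn adds one full circle. Induction in both
  directions covers negative \<open>n\<close>.\<close>

lemma arc_winds:
  assumes full: "\<And>w. w \<noteq> 0 \<Longrightarrow> G w \<in> S"
  shows "arc 0 (t + 2 * pi * of_int n) - arc 0 t - chain_smult (of_int n) (arc 0 (2 * pi))
    \<in> (field_boundaries 1 (top_of_set S) :: ('a, 'f::field) field_chain set)"
proof -
  let ?B = "field_boundaries 1 (top_of_set S) :: ('a, 'f) field_chain set"
  note sub = subspace_field_boundaries [of 1 "top_of_set S"]
  have step: "arc 0 (u + 2 * pi) - arc 0 u - arc 0 (2 * pi) \<in> ?B" for u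
  proof -
    have "arc (2 * pi) (u + 2 * pi) - arc 0 (u + 2 * pi) + arc 0 (2 * pi) \<in> ?B"
      by (rule arc_triangle [of UNIV]) (auto intro: full)
    moreover have "arc (2 * pi) (u + 2 * pi) = (arc 0 u :: ('a, 'f) field_chain)"
      using arc_shift [of 0 1 u] by simp
    ultimately show ?thesis
      using chain.subspace_neg [OF sub] by (fastforce simp: algebra_simps)
  qed
  show ?thesis
  proof (induction n rule: int_induct [of _ 0])
    case base
    show ?case using chain.subspace_0 [OF sub] by simp
  next
    case (step1 i)
    from chain.subspace_add [OF sub step1(2) step [of "t + 2 * pi * of_int i"]]
    show ?case
      by (simp add: algebra_simps chain.scale_left_distrib)
  next
    case (step2 i)
    from chain.subspace_diff [OF sub step2(2) step [of "t + 2 * pi * of_int (i - 1)"]]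
    show ?case
      by (simp add: algebra_simps chain.scale_left_diff_distrib)
  qed
qed

lemma path_logarithm:
  assumes "continuous_on {0..1} p" "p ` {0..1} \<subseteq> S"
  obtains h where "continuous_on {0..1::real} h" "\<And>s. s \<in> {0..1} \<Longrightarrow> \<Phi> (p s) = exp (h s)"
proof -
  have "continuous_on {0..1} (\<lambda>s. \<Phi> (p s))"
    using assms by (intro continuous_on_compose2 [OF cont_\<Phi>])
  then show thesis
    using continuous_logarithm_on_contractible [of "{0..1}" "\<lambda>s. \<Phi> (p s)"] assms \<Phi>_nonzero that
    by (auto simp: convex_imp_contractible image_subset_iff)
qed

text \<open>The endpoint term for \<open>z\<close> leads from the angle \<open>0\<close> to the
  principal angle of \<open>\<Phi> z\<close> and back along the track to \<open>z\<close>. Once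
  these terms are removed, a path is homologous to as many full circles as its winding number
  says.\<close>

lemma cycle_homologous_winding:
  assumes full: "\<And>w. w \<noteq> 0 \<Longrightarrow> G w \<in> S"
    and c: "c \<in> (field_cycles 1 (top_of_set S) :: ('a, 'f::field) field_chain set)"
  shows "c - chain_smult (winding_functional \<Phi> c) (arc 0 (2 * pi)) \<in> field_boundaries 1 (top_of_set S)"
  unfolding winding_functional_def
proof (rule cycle_homologous_multiple [OF c, where T = "\<lambda>z. arc 0 (Arg (\<Phi> z)) - track z"])
  fix \<sigma>
  assume \<sigma>: "singular_simplex 1 (top_of_set S) \<sigma>"
  let ?B = "field_boundaries 1 (top_of_set S) :: ('a, 'f) field_chain set"
  note sub = subspace_field_boundaries [of 1 "top_of_set S"]
  define p where "p = simplex_path \<sigma>"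
  have p: "continuous_on {0..1} p" "p ` {0..1} \<subseteq> S"
    using continuous_on_simplex_path [OF \<sigma>] by (auto simp: p_def)
  then obtain h where h: "continuous_on {0..1} h" "\<And>s. s \<in> {0..1} \<Longrightarrow> \<Phi> (p s) = exp (h s)"
    using path_logarithm by blast
  define n where "n = path_winding (\<Phi> \<circ> p)"
  \<comment> \<open>The logarithm starts \<open>m0\<close> turns away from the principal angle and
    ends \<open>n + m0\<close> turns away from it; only the difference \<open>n\<close>
    survives.\<close>
  obtain m0 :: int where m0: "Im (h 0) = Arg (\<Phi> (p 0)) + 2 * pi * m0"
    using Im_log_eq_Arg [OF h(2), of 0] by auto
  have m1: "Im (h 1) = Arg (\<Phi> (p 1)) + 2 * pi * of_int (n + m0)"
    using path_winding_eq [of h "\<Phi> \<circ> p"] h m0 by (simp add: n_def algebra_simps)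
  let ?K = "arc 0 (2 * pi) :: ('a, 'f) field_chain"
  have 1: "arc (Im (h 0)) (Im (h 1)) - arc 0 (Im (h 1)) + arc 0 (Im (h 0)) \<in> ?B"
    by (rule arc_triangle [of UNIV]) (auto intro: full)
  have 2: "arc 0 (Im (h 1)) - arc 0 (Arg (\<Phi> (p 1))) - chain_smult (of_int (n + m0)) ?K \<in> ?B"
    unfolding m1 by (rule arc_winds [OF full])
  have 3: "arc 0 (Im (h 0)) - arc 0 (Arg (\<Phi> (p 0))) - chain_smult (of_int m0) ?K \<in> ?B"
    unfolding m0 by (rule arc_winds [OF full])
  from chain.subspace_diff [OF sub chain.subspace_add [OF sub
        chain.subspace_add [OF sub path_homologous_arc(1) [OF p h] 1] 2] 3]
  have "path_chain p - (arc 0 (Arg (\<Phi> (p 1))) - track (p 1) - (arc 0 (Arg (\<Phi> (p 0))) - track (p 0))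
      + chain_smult (of_int n) ?K) \<in> ?B"
    by (simp add: algebra_simps chain.scale_left_distrib)
  then show "Poly_Mapping.single \<sigma> 1 - (arc 0 (Arg (\<Phi> (simplex_path \<sigma> 1))) - track (simplex_path \<sigma> 1)
      - (arc 0 (Arg (\<Phi> (simplex_path \<sigma> 0))) - track (simplex_path \<sigma> 0))
      + chain_smult (of_int (path_winding (\<Phi> \<circ> simplex_path \<sigma>))) ?K) \<in> ?B"
    by (simp add: p_def n_def path_chain_simplex_path [OF \<sigma>])
qed

text \<open>A missing direction permits a logarithm on all of \<open>S\<close>, so the angle becomes
  a function of the point and no multiple of a generator occurs. The set \<open>W\<close> of allowed
  angles may be disconnected, therefore the endpoint term starts at a base angle chosen in each
  component.\<close>

lemma cycle_null_homologous:
  assumes missing: "G (cis t0) \<notin> S"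
    and c: "c \<in> (field_cycles 1 (top_of_set S) :: ('a, 'f::field) field_chain set)"
  shows "c \<in> field_boundaries 1 (top_of_set S)"
proof -
  define W where "W = {t. G (cis t) \<in> S}"
  \<comment> \<open>The choice depends on \<open>t\<close> only through its component, so both ends
    of a path receive the same base angle.\<close>
  define base where "base = (\<lambda>t. SOME b. b \<in> connected_component_set W t)"
  \<comment> \<open>The principal logarithm, rotated so that its cut lies on the ray through
    \<open>cis t0\<close>, which \<open>\<Phi>\<close> does not meet on \<open>S\<close>; the added
    constant is a logarithm of \<open>- cis t0\<close> and undoes the rotation.\<close>
  define L where "L = (\<lambda>z. Ln (- \<Phi> z / cis t0) + \<i> * of_real (t0 + pi))"
  have exp_L: "exp (L z) = \<Phi> z" if "z \<in> S" for z
  proof -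
    have "exp (\<i> * of_real (t0 + pi)) = - cis t0"
      by (simp only: cis_conv_exp [symmetric] cis_mult [symmetric] cis_pi) simp
    then show ?thesis
      using \<Phi>_nonzero [OF that] by (simp add: L_def exp_add exp_Ln)
  qed
  have "- \<Phi> z / cis t0 \<notin> \<real>\<^sub>\<le>\<^sub>0" if "z \<in> S" for z
  proof
    assume "- \<Phi> z / cis t0 \<in> \<real>\<^sub>\<le>\<^sub>0"
    then obtain r where r: "r \<le> 0" "- \<Phi> z / cis t0 = of_real r"
      by (elim nonpos_Reals_cases)
    then have eq: "\<Phi> z = of_real (- r) * cis t0"
      by (simp add: field_simps) (metis add.inverse_inverse)
    then have "0 < - r"
      using r \<Phi>_nonzero [OF that] by (cases "r = 0") auto
    then have "G (\<Phi> z) = G (cis t0)"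
      unfolding eq by (rule G_scale)
    then show False
      using segment_subset [OF that] missing by auto
  qed
  then have cont_L: "continuous_on S L"
    unfolding L_def by (intro continuous_intros cont_\<Phi>) auto
  have "c - chain_smult (linear_ext (*) (\<lambda>\<sigma>. 0) c) 0 \<in> field_boundaries 1 (top_of_set S)"
  proof (rule cycle_homologous_multiple
      [OF c, where T = "\<lambda>z. arc (base (Im (L z))) (Im (L z)) - track z"])
    fix \<sigma>
    assume \<sigma>: "singular_simplex 1 (top_of_set S) \<sigma>"
    let ?B = "field_boundaries 1 (top_of_set S) :: ('a, 'f) field_chain set"
    note sub = subspace_field_boundaries [of 1 "top_of_set S"]
    define p where "p = simplex_path \<sigma>"
    have p: "continuous_on {0..1} p" "p ` {0..1} \<subseteq> S"
      using continuous_on_simplex_path [OF \<sigma>] by (auto simp: p_def)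
    define h where "h = (\<lambda>s. L (p s))"
    have h: "continuous_on {0..1} h" "\<And>s. s \<in> {0..1} \<Longrightarrow> \<Phi> (p s) = exp (h s)"
      unfolding h_def using p exp_L by (auto intro: continuous_on_compose2 [OF cont_L] simp: image_subset_iff)
    define J where "J = connected_component_set W (Im (h 0))"
    have seg: "closed_segment (Im (h 0)) (Im (h 1)) \<subseteq> W"
      using path_homologous_arc(2) [OF p h] by (auto simp: W_def)
    then have 01: "Im (h 0) \<in> J" "Im (h 1) \<in> J"
      unfolding J_def using connected_component_maximal [OF _ connected_segment(1) seg, of "Im (h 0)"]
      by (auto simp: subset_iff)
    have J1: "connected_component_set W (Im (h 1)) = J"
      using 01 unfolding J_def by (metis connected_component_eq)
    have J: "convex J" "\<And>t. t \<in> J \<Longrightarrow> G (cis t) \<in> S"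
      using connected_component_subset [of W] by (auto simp: J_def W_def simp flip: connected_convex_1 subset_iff)
    have base: "base (Im (h 0)) = base (Im (h 1))" "base (Im (h 0)) \<in> J"
      unfolding base_def J1 J_def [symmetric] using 01(1) by (auto intro: someI)
    have "arc (Im (h 0)) (Im (h 1)) - arc (base (Im (h 0))) (Im (h 1)) + arc (base (Im (h 0))) (Im (h 0)) \<in> ?B"
      by (rule arc_triangle [OF J base(2) 01])
    from chain.subspace_add [OF sub path_homologous_arc(1) [OF p h] this]
    have "path_chain p - (arc (base (Im (h 1))) (Im (h 1)) - track (p 1)
        - (arc (base (Im (h 0))) (Im (h 0)) - track (p 0))) \<in> ?B"
      by (simp add: algebra_simps base(1))
    then show "Poly_Mapping.single \<sigma> 1 - (arc (base (Im (L (simplex_path \<sigma> 1)))) (Im (L (simplex_path \<sigma> 1)))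
        - track (simplex_path \<sigma> 1) - (arc (base (Im (L (simplex_path \<sigma> 0)))) (Im (L (simplex_path \<sigma> 0)))
        - track (simplex_path \<sigma> 0)) + chain_smult 0 0) \<in> ?B"
      by (simp add: p_def h_def path_chain_simplex_path [OF \<sigma>])
  qed
  then show ?thesis
    by simp
qed

text \<open>Along the loop \<open>\<Phi>\<close> is a positive multiple of
  \<open>cis (2 * pi * s)\<close>, which makes a logarithm with imaginary part
  \<open>2 * pi * s\<close> explicit; the \<open>Arg\<close> terms cancel because the loop is
  closed.\<close>

lemma arc_generator:
  assumes full: "\<And>w. w \<noteq> 0 \<Longrightarrow> G w \<in> S"
    and \<Phi>_G: "\<And>w. w \<noteq> 0 \<Longrightarrow> \<exists>c>0. \<Phi> (G w) = of_real c * w"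
  shows "arc 0 (2 * pi) \<in> (field_cycles 1 (top_of_set S) :: ('a, 'f::field) field_chain set)"
    and "winding_functional \<Phi> (arc 0 (2 * pi)) = (1 :: 'f)"
proof -
  let ?p = "\<lambda>s. G (cis ((1 - s) * 0 + s * (2 * pi)))"
  have p: "continuous_on {0..1} ?p" "?p ` {0..1} \<subseteq> S"
    by (auto intro!: continuous_intros full)
  then show "arc 0 (2 * pi) \<in> (field_cycles 1 (top_of_set S) :: ('a, 'f) field_chain set)"
    unfolding arc_def by (rule path_chain_cycle) simp
  let ?q = "\<Phi> \<circ> simplex_path (path_simplex ?p)"
  define h where "h = (\<lambda>s. of_real (ln (cmod (\<Phi> (?p s)))) + \<i> * of_real (2 * pi * s))"
  have "continuous_on {0..1} (\<lambda>s. \<Phi> (?p s))"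
    by (rule continuous_on_compose2 [OF cont_\<Phi> p])
  then have "continuous_on {0..1} h"
    unfolding h_def using p(2) \<Phi>_nonzero by (intro continuous_intros) auto
  moreover have "?q s = exp (h s)" if s: "s \<in> {0..1}" for s
  proof -
    obtain r where r: "r > 0" "\<Phi> (?p s) = of_real r * cis (2 * pi * s)"
      using \<Phi>_G [of "cis (2 * pi * s)"] by (auto simp: mult_ac)
    then have "cmod (\<Phi> (?p s)) = r"
      by (simp add: norm_mult)
    then have "exp (h s) = exp (of_real (ln r)) * exp (\<i> * of_real (2 * pi * s))"
      by (simp only: h_def exp_add)
    also have "\<dots> = \<Phi> (?p s)"
      using r by (simp only: exp_of_real exp_ln cis_conv_exp)
    finally show ?thesis
      using simplex_path_path_simplex [OF s, of ?p] by simp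
  qed
  ultimately have "2 * pi * path_winding ?q = (Im (h 1) - Im (h 0)) - (Arg (?q 1) - Arg (?q 0))"
    by (rule path_winding_eq)
  moreover have "Arg (?q 1) = Arg (?q 0)"
    by (simp add: simplex_path_path_simplex)
  moreover have "Im (h 1) - Im (h 0) = 2 * pi"
    by (simp add: h_def)
  ultimately have "2 * pi * path_winding ?q = 2 * pi"
    by linarith
  then have "path_winding ?q = 1"
    by simp
  then show "winding_functional \<Phi> (arc 0 (2 * pi)) = (1 :: 'f)"
    by (simp only: winding_functional_def arc_def path_chain_def
        vector_space_over_itself.linear_ext_single of_int_1 mult_1)
qed

end

section \<open>The geometry of the configuration spaces\<close>

lemma edge_point_component: "edge_point i t $ j = (if j = i then t else 0)"
  by (simp add: edge_point_def axis_def)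

lemma mem_Y_graph:
  "x \<in> Y_graph \<longleftrightarrow> (\<forall>i. 0 \<le> x $ i \<and> x $ i \<le> 1) \<and> (\<forall>i j. i \<noteq> j \<longrightarrow> x $ i = 0 \<or> x $ j = 0)"
    (is "_ \<longleftrightarrow> ?rhs")
proof
  assume "x \<in> Y_graph"
  then show ?rhs
    by (auto simp: Y_graph_def edge_point_component)
next
  assume rhs: ?rhs
  obtain i where "\<And>j. j \<noteq> i \<Longrightarrow> x $ j = 0"
    using rhs by metis
  then have "x = edge_point i (x $ i)"
    by (simp add: vec_eq_iff edge_point_component)
  then show "x \<in> Y_graph"
    using rhs unfolding Y_graph_def by (intro UN_I [OF UNIV_I] image_eqI) auto
qed

section \<open>The path metric as a weighted norm\<close>

definition weighted_norm :: "real \<Rightarrow> real ^ 3 \<Rightarrow> real" where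
  "weighted_norm L v = (\<Sum>i\<in>UNIV. edge_length L i * \<bar>v $ i\<bar>)"

lemma weighted_norm_scale: "weighted_norm L (c *\<^sub>R v) = \<bar>c\<bar> * weighted_norm L v"
  by (simp add: weighted_norm_def sum_distrib_left abs_mult mult_ac)

lemma edge_length_pos: "0 < L \<Longrightarrow> 0 < edge_length L i"
  by (simp add: edge_length_def)

lemma weighted_norm_triangle:
  assumes "0 < L"
  shows "weighted_norm L (x - z) \<le> weighted_norm L (x - y) + weighted_norm L (y - z)"
  unfolding weighted_norm_def sum.distrib [symmetric] distrib_left [symmetric]
  using edge_length_pos [OF assms] by (intro sum_mono mult_left_mono) (auto simp: less_imp_le)

lemma weighted_norm_edge:
  "weighted_norm L (edge_point i s - edge_point i t) = edge_length L i * \<bar>s - t\<bar>"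
proof -
  have "weighted_norm L (edge_point i s - edge_point i t)
      = (\<Sum>j\<in>UNIV. if j = i then edge_length L i * \<bar>s - t\<bar> else 0)"
    unfolding weighted_norm_def by (rule sum.cong) (auto simp: edge_point_component)
  then show ?thesis
    by simp
qed

text \<open>A segment has exactly the weighted norm of its difference vector as length, and the
  triangle inequality adds these up.\<close>

lemma weighted_norm_le_pl_path:
  assumes "pl_path L x y d" "0 < L"
  shows "weighted_norm L (x - y) \<le> d"
  using assms(1)
proof induction
  case (pl_refl x)
  then show ?case
    by (simp add: weighted_norm_def)
next
  case (pl_step s t i y d)
  then show ?case
    using weighted_norm_triangle [OF assms(2), of "edge_point i s" y "edge_point i t"]
      weighted_norm_edge [of L i s t] by linarith
qed

text \<open>The infimum is attained: by one segment on a common edge, otherwise by two segments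
  through the centre, where the two supports are disjoint.\<close>

lemma pl_path_weighted_norm:
  assumes "x \<in> Y_graph" "y \<in> Y_graph"
  shows "pl_path L x y (weighted_norm L (x - y))"
proof -
  obtain i s where x: "x = edge_point i s" and s: "s \<in> {0..1}"
    using assms(1) by (auto simp: Y_graph_def)
  obtain j t where y: "y = edge_point j t" and t: "t \<in> {0..1}"
    using assms(2) by (auto simp: Y_graph_def)
  have yy: "pl_path L (edge_point j t) y 0"
    using assms(2) y by (auto intro: pl_refl)
  show ?thesis
  proof (cases "i = j")
    case True
    with pl_step [OF s t, of L j y 0] yy show ?thesis
      by (simp add: x y weighted_norm_edge)
  next
    case False
    have "edge_point i 0 = edge_point j 0"
      by (simp add: edge_point_def)
    with pl_step [OF _ t yy, of 0]
    have "pl_path L (edge_point i 0) y (edge_length L j * \<bar>0 - t\<bar> + 0)"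
      by simp
    from pl_step [OF s _ this]
    have path: "pl_path L x y (edge_length L i * \<bar>s - 0\<bar> + (edge_length L j * \<bar>0 - t\<bar> + 0))"
      by (simp add: x)
    have "weighted_norm L (x - y)
        = (\<Sum>k\<in>UNIV. (if k = i then edge_length L i * \<bar>s\<bar> else 0) + (if k = j then edge_length L j * \<bar>t\<bar> else 0))"
      unfolding weighted_norm_def using False by (intro sum.cong) (auto simp: edge_point_component x y)
    also have "\<dots> = edge_length L i * \<bar>s\<bar> + edge_length L j * \<bar>t\<bar>"
      by (simp add: sum.distrib)
    finally show ?thesis
      using path by simp
  qed
qed

lemma path_metric_eq_weighted_norm:
  assumes "0 < L" "x \<in> Y_graph" "y \<in> Y_graph"
  shows "path_metric L x y = weighted_norm L (x - y)"
  unfolding path_metric_def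
  using pl_path_weighted_norm [OF assms(2,3)] weighted_norm_le_pl_path [OF _ assms(1)]
  by (intro cInf_eq_minimum) auto

lemma mem_Y_conf2:
  assumes "0 < L"
  shows "(x, y) \<in> Y_conf2 r L \<longleftrightarrow> x \<in> Y_graph \<and> y \<in> Y_graph \<and> r \<le> weighted_norm L (x - y)"
  using path_metric_eq_weighted_norm [OF assms] by (auto simp: Y_conf2_def)

lemma Y_conf2_mono:
  assumes "0 < L" "L \<le> L'" "r' \<le> r"
  shows "Y_conf2 r L \<subseteq> Y_conf2 r' L'"
proof -
  have "weighted_norm L v \<le> weighted_norm L' v" for v
    unfolding weighted_norm_def using assms
    by (intro sum_mono mult_right_mono) (auto simp: edge_length_def)
  then show ?thesis
    using assms mem_Y_conf2 [of L] mem_Y_conf2 [of L'] by (fastforce intro: order_trans)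
qed

text \<open>The plane into which the configuration space is mapped is the quotient of \<open>\<real>\<^sup>3\<close> by the
  diagonal. A vector is balanced iff its median coordinate is \<open>0\<close>, so \<open>balanced_lift\<close>, which
  subtracts the median, inverts the quotient map on the balanced vectors.\<close>

definition balanced :: "real ^ 3 \<Rightarrow> bool" where
  "balanced v \<longleftrightarrow> (\<forall>i j. i \<noteq> j \<longrightarrow> v $ i * v $ j \<le> 0)"

definition plane_proj :: "real ^ 3 \<Rightarrow> complex" where
  "plane_proj v = Complex (v $ 1 - v $ 3) (v $ 2 - v $ 3)"

text \<open>The median of \<open>Re w\<close>, \<open>Im w\<close> and \<open>0\<close>, the
  coordinates of one preimage of \<open>w\<close> under \<open>plane_proj\<close>. Built from
  \<open>max\<close> and \<open>min\<close>, it is visibly continuous.\<close>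

definition median0 :: "complex \<Rightarrow> real" where
  "median0 w = max (min (Re w) (Im w)) (min (max (Re w) (Im w)) 0)"

definition balanced_lift :: "complex \<Rightarrow> real ^ 3" where
  "balanced_lift w = (Re w - median0 w) *\<^sub>R axis 1 1 + (Im w - median0 w) *\<^sub>R axis 2 1
    - median0 w *\<^sub>R axis 3 1"

lemma balanced_lift_component:
  "balanced_lift w $ 1 = Re w - median0 w" "balanced_lift w $ 2 = Im w - median0 w"
  "balanced_lift w $ 3 = - median0 w"
  by (simp_all add: balanced_lift_def axis_def)

lemma balanced_iff:
  "balanced v \<longleftrightarrow> v $ 1 * v $ 2 \<le> 0 \<and> v $ 1 * v $ 3 \<le> 0 \<and> v $ 2 * v $ 3 \<le> 0"
  unfolding balanced_def forall_3 by (auto simp: mult.commute)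

lemma balanced_lift_balanced: "balanced (balanced_lift w)"
  unfolding balanced_iff balanced_lift_component median0_def
  by (auto simp: mult_le_0_iff zero_le_mult_iff max_def min_def)

text \<open>The preimage of \<open>plane_proj v\<close> with third coordinate \<open>0\<close> is
  \<open>v\<close> shifted by \<open>- (v $ 3)\<close>. Since \<open>v\<close> has median
  \<open>0\<close>, the shift is also the median, and subtracting it recovers
  \<open>v\<close>.\<close>

lemma balanced_lift_plane_proj:
  assumes "balanced v"
  shows "balanced_lift (plane_proj v) = v"
proof -
  have "median0 (plane_proj v) = - (v $ 3)"
    using assms unfolding balanced_iff median0_def plane_proj_def
    by (auto simp: mult_le_0_iff max_def min_def)
  then show ?thesis
    by (simp add: vec_eq_iff forall_3 balanced_lift_component) (simp add: plane_proj_def)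
qed

lemma plane_proj_balanced_lift: "plane_proj (balanced_lift w) = w"
  by (simp add: plane_proj_def balanced_lift_component complex_eq_iff)

lemma plane_proj_scale: "plane_proj (c *\<^sub>R v) = of_real c * plane_proj v"
  by (simp add: plane_proj_def complex_eq_iff algebra_simps)

text \<open>Positive multiples of balanced vectors are balanced, and a balanced vector is determined
  by its projection.\<close>

lemma balanced_lift_scale:
  assumes "0 < c"
  shows "balanced_lift (of_real c * w) = c *\<^sub>R balanced_lift w"
proof -
  have "balanced (c *\<^sub>R balanced_lift w)"
    using balanced_lift_balanced [of w] assms
    by (auto simp: balanced_iff mult_le_0_iff zero_le_mult_iff)
  from balanced_lift_plane_proj [OF this] show ?thesis
    by (simp add: plane_proj_scale plane_proj_balanced_lift)
qed

section \<open>Outer configurations and the deformation onto them\<close>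

definition maxabs :: "real ^ 3 \<Rightarrow> real" where
  "maxabs v = max \<bar>v $ 1\<bar> (max \<bar>v $ 2\<bar> \<bar>v $ 3\<bar>)"

lemma maxabs_ge: "\<bar>v $ i\<bar> \<le> maxabs v"
  using exhaust_3 [of i] by (auto simp: maxabs_def)

lemma maxabs_attained: "\<exists>i. maxabs v = \<bar>v $ i\<bar>"
  unfolding maxabs_def max_def by auto

lemma maxabs_pos: "v \<noteq> 0 \<Longrightarrow> 0 < maxabs v"
  unfolding vec_eq_iff forall_3 maxabs_def by auto

lemma maxabs_scale: "0 < c \<Longrightarrow> maxabs (c *\<^sub>R v) = c * maxabs v"
  by (simp add: maxabs_def abs_mult max_mult_distrib_left)

text \<open>A balanced vector has at most one positive and one negative coordinate; if these are at
  most \<open>1\<close> in modulus, both parts are points of the graph.\<close>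

definition split_parts :: "real ^ 3 \<Rightarrow> (real ^ 3) \<times> (real ^ 3)" where
  "split_parts v = (\<chi> i. max (v $ i) 0, \<chi> i. max (- (v $ i)) 0)"

lemma split_parts_diff: "fst (split_parts v) - snd (split_parts v) = v"
  by (auto simp: split_parts_def vec_eq_iff max_def)

definition conf_direction :: "(real ^ 3) \<times> (real ^ 3) \<Rightarrow> complex" where
  "conf_direction z = plane_proj (fst z - snd z)"

text \<open>For \<open>w \<noteq> 0\<close> this is the farthest configuration in the direction of
  \<open>w\<close>: the scaling is the largest that keeps all coordinates at most \<open>1\<close>
  in modulus.\<close>

definition outer_conf :: "complex \<Rightarrow> (real ^ 3) \<times> (real ^ 3)" where
  "outer_conf w = split_parts (balanced_lift w /\<^sub>R maxabs (balanced_lift w))"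

lemma balanced_lift_nonzero:
  assumes "w \<noteq> 0"
  shows "balanced_lift w \<noteq> 0"
  using assms plane_proj_balanced_lift [of w] by (auto simp: plane_proj_def complex_eq_iff)

lemma conf_direction_outer_conf:
  "conf_direction (outer_conf w) = of_real (inverse (maxabs (balanced_lift w))) * w"
  by (simp only: conf_direction_def outer_conf_def split_parts_diff plane_proj_scale
      plane_proj_balanced_lift)

lemma outer_conf_scale:
  assumes "0 < c"
  shows "outer_conf (of_real c * w) = outer_conf w"
proof -
  have "inverse (c * m) * c = inverse m" for m
    using assms by (simp add: field_simps)
  then show ?thesis
    using assms by (simp add: outer_conf_def balanced_lift_scale maxabs_scale del: inverse_mult_distrib)
qed

lemma continuous_on_conf_direction: "continuous_on U conf_direction"
  unfolding conf_direction_def [abs_def] plane_proj_def Complex_eq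
  by (intro continuous_intros)

lemma continuous_on_outer_conf: "continuous_on (- {0}) outer_conf"
proof -
  have lift: "continuous_on U balanced_lift" for U
    unfolding balanced_lift_def [abs_def] median0_def by (intro continuous_intros)
  have "continuous_on (- {0}) (\<lambda>w. maxabs (balanced_lift w))"
    unfolding maxabs_def by (intro continuous_intros lift)
  moreover have "maxabs (balanced_lift w) \<noteq> 0" if "w \<in> - {0}" for w
    using that maxabs_pos [OF balanced_lift_nonzero [of w]] by auto
  ultimately have unit: "continuous_on (- {0}) (\<lambda>w. balanced_lift w /\<^sub>R maxabs (balanced_lift w))"
    by (intro continuous_intros lift) auto
  show ?thesis
    unfolding outer_conf_def [abs_def] split_parts_def by (intro continuous_intros unit)
qed

text \<open>Two coordinates of the difference with the same strict sign would give two nonzero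
  coordinates of the same point.\<close>

lemma balanced_diff:
  assumes "x \<in> Y_graph" "y \<in> Y_graph"
  shows "balanced (x - y)"
  unfolding balanced_def
proof (intro allI impI)
  fix i j :: 3
  assume "i \<noteq> j"
  then have "x $ i = 0 \<or> x $ j = 0" "y $ i = 0 \<or> y $ j = 0"
    "0 \<le> x $ i" "0 \<le> x $ j" "0 \<le> y $ i" "0 \<le> y $ j"
    using assms by (auto simp: mem_Y_graph)
  then show "(x - y) $ i * (x - y) $ j \<le> 0"
    by (auto simp: mult_le_0_iff)
qed

lemma weighted_norm_pos_imp: "0 < weighted_norm L v \<Longrightarrow> v \<noteq> 0"
  by (auto simp: weighted_norm_def)

text \<open>By \<open>supp\<close> the target of \<open>x\<close> vanishes wherever \<open>x\<close>
  does, so \<open>x\<close> moves along its own edge, and likewise \<open>y\<close>. Meanwhile the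
  difference vector is only multiplied by \<open>1 - u + u / m\<close>, which is at least
  \<open>1\<close> because \<open>m \<le> 1\<close>.\<close>

lemma Y_conf2_segment:
  assumes "0 < r" "0 < L" and z: "z \<in> Y_conf2 r L"
  shows "closed_segment z (outer_conf (conf_direction z)) \<subseteq> Y_conf2 r L"
proof
  fix q
  assume "q \<in> closed_segment z (outer_conf (conf_direction z))"
  then obtain u where u: "0 \<le> u" "u \<le> 1" and q: "q = (1 - u) *\<^sub>R z + u *\<^sub>R outer_conf (conf_direction z)"
    by (auto simp: in_segment)
  obtain x y where xy: "z = (x, y)"
    by (cases z)
  define v where "v = x - y"
  define m where "m = maxabs v"
  have Y: "x \<in> Y_graph" "y \<in> Y_graph" and norm: "r \<le> weighted_norm L v"
    using z assms(2) by (auto simp: xy mem_Y_conf2 v_def)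
  have outer: "outer_conf (conf_direction z) = split_parts (v /\<^sub>R m)"
    using balanced_lift_plane_proj [OF balanced_diff [OF Y]]
    by (simp add: outer_conf_def conf_direction_def xy v_def m_def)
  have "v \<noteq> 0"
    using norm assms(1) by (intro weighted_norm_pos_imp [of L]) auto
  then have m: "0 < m"
    using maxabs_pos by (simp add: m_def)
  have xy01: "0 \<le> x $ i" "x $ i \<le> 1" "0 \<le> y $ i" "y $ i \<le> 1" for i
    using Y by (auto simp: mem_Y_graph)
  have "m \<le> 1"
  proof -
    obtain i where "m = \<bar>v $ i\<bar>"
      using maxabs_attained by (auto simp: m_def)
    then show ?thesis
      using xy01 [of i] by (auto simp: v_def)
  qed
  define x' y' where "x' = fst (split_parts (v /\<^sub>R m))" and "y' = snd (split_parts (v /\<^sub>R m))"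
  have unit: "- 1 \<le> v $ i / m" "v $ i / m \<le> 1" for i
    using maxabs_ge [of v i] m by (auto simp: m_def field_simps)
  have x': "x' $ i = max (v $ i / m) 0" and y': "y' $ i = max (- (v $ i / m)) 0" for i
    by (simp_all add: x'_def y'_def split_parts_def divide_inverse mult.commute)
  have x'01: "0 \<le> x' $ i" "x' $ i \<le> 1" "0 \<le> y' $ i" "y' $ i \<le> 1" for i
    using unit [of i] by (auto simp: x' y')
  \<comment> \<open>Where \<open>x\<close> vanishes, the difference is \<open>- (y $ i)\<close> and
    has no positive part; where \<open>y\<close> vanishes, it has no negative part.\<close>
  have supp: "x $ i = 0 \<Longrightarrow> x' $ i = 0" "y $ i = 0 \<Longrightarrow> y' $ i = 0" for i
    using xy01 [of i] m by (auto simp: x' y' v_def divide_nonneg_pos divide_nonpos_pos max_def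
        divide_le_0_iff zero_le_divide_iff)
  have "(1 - u) *\<^sub>R x + u *\<^sub>R x' \<in> Y_graph" "(1 - u) *\<^sub>R y + u *\<^sub>R y' \<in> Y_graph"
    unfolding mem_Y_graph using u xy01 x'01 supp Y
    by (auto simp: mem_Y_graph convex_bound_le) (metis add.right_neutral mult_zero_right)+
  moreover have "r \<le> weighted_norm L (((1 - u) *\<^sub>R x + u *\<^sub>R x') - ((1 - u) *\<^sub>R y + u *\<^sub>R y'))"
  proof -
    have "x' - y' = v /\<^sub>R m"
      by (simp add: x'_def y'_def split_parts_diff)
    moreover have "((1 - u) *\<^sub>R x + u *\<^sub>R x') - ((1 - u) *\<^sub>R y + u *\<^sub>R y') = (1 - u) *\<^sub>R v + u *\<^sub>R (x' - y')"
      by (simp add: v_def algebra_simps)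
    ultimately have "((1 - u) *\<^sub>R x + u *\<^sub>R x') - ((1 - u) *\<^sub>R y + u *\<^sub>R y') = (1 - u) *\<^sub>R v + u *\<^sub>R (v /\<^sub>R m)"
      by simp
    also have "\<dots> = (1 - u + u / m) *\<^sub>R v"
      by (simp add: scaleR_left_distrib divide_inverse)
    finally have eq: "((1 - u) *\<^sub>R x + u *\<^sub>R x') - ((1 - u) *\<^sub>R y + u *\<^sub>R y') = (1 - u + u / m) *\<^sub>R v" .
    have "u \<le> u / m"
      using u m \<open>m \<le> 1\<close> by (simp add: le_divide_eq mult_left_le)
    then have "1 * weighted_norm L v \<le> \<bar>1 - u + u / m\<bar> * weighted_norm L v"
      using norm assms(1) by (intro mult_right_mono) auto
    then show ?thesis
      unfolding eq weighted_norm_scale using norm by linarith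
  qed
  moreover have "q = ((1 - u) *\<^sub>R x + u *\<^sub>R x', (1 - u) *\<^sub>R y + u *\<^sub>R y')"
    unfolding q outer by (simp add: xy x'_def y'_def prod_eq_iff)
  ultimately show "q \<in> Y_conf2 r L"
    using assms(2) by (simp add: mem_Y_conf2)
qed

text \<open>The coordinate of modulus \<open>1\<close> alone contributes a full edge length, which
  is \<open>1\<close> or \<open>L\<close> and hence at least \<open>r\<close>.\<close>

lemma outer_conf_in_Y_conf2:
  assumes "0 < r" "r \<le> 1" "r \<le> L" "w \<noteq> 0"
  shows "outer_conf w \<in> Y_conf2 r L"
proof -
  define v where "v = balanced_lift w"
  define m where "m = maxabs v"
  define u where "u = v /\<^sub>R m"
  have m: "0 < m"
    using maxabs_pos [OF balanced_lift_nonzero [OF assms(4)]] by (simp add: m_def v_def)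
  have u_le: "\<bar>u $ i\<bar> \<le> 1" for i
    using maxabs_ge [of v i] m by (simp add: u_def m_def abs_mult divide_simps)
  obtain k where "m = \<bar>v $ k\<bar>"
    using maxabs_attained by (auto simp: m_def)
  then have k: "\<bar>u $ k\<bar> = 1"
    using m by (simp add: u_def abs_mult)
  have bal: "u $ i * u $ j \<le> 0" if "i \<noteq> j" for i j
  proof -
    have "v $ i * v $ j \<le> 0"
      using balanced_lift_balanced [of w] that by (simp add: balanced_def v_def)
    then have "(inverse m * inverse m) * (v $ i * v $ j) \<le> 0"
      using m by (intro mult_nonneg_nonpos [of "inverse m * inverse m"]) auto
    then show ?thesis
      by (simp add: u_def mult_ac)
  qed
  have "fst (split_parts u) \<in> Y_graph" "snd (split_parts u) \<in> Y_graph"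
    using u_le bal by (auto simp: mem_Y_graph split_parts_def abs_le_iff max_def mult_le_0_iff)
  moreover have "r \<le> weighted_norm L u"
  proof -
    have "r \<le> edge_length L k * \<bar>u $ k\<bar>"
      using assms k by (simp add: edge_length_def)
    also have "\<dots> \<le> weighted_norm L u"
      unfolding weighted_norm_def using assms
      by (intro member_le_sum) (auto simp: edge_length_def)
    finally show ?thesis .
  qed
  ultimately have "(fst (split_parts u), snd (split_parts u)) \<in> Y_conf2 r L"
    using assms by (subst mem_Y_conf2) (auto simp: split_parts_diff)
  then show ?thesis
    by (simp add: outer_conf_def u_def v_def m_def)
qed

text \<open>In the directions \<open>1\<close> and \<open>\<i>\<close> one point is at the leaf of
  the first or second edge and the other at the centre, so their distance is exactly
  \<open>L\<close> or \<open>1\<close>.\<close>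

lemma outer_conf_notin_Y_conf2:
  assumes "0 < L" "L < r \<or> 1 < r"
  shows "\<exists>t. outer_conf (cis t) \<notin> Y_conf2 r L"
proof -
  have eq: "outer_conf 1 = split_parts (axis 1 1)" "outer_conf \<i> = split_parts (axis 2 1)"
  proof -
    have "balanced (axis i 1)" for i
      by (auto simp: balanced_def axis_def)
    note lift = balanced_lift_plane_proj [OF this]
    have "plane_proj (axis 1 1) = 1" "plane_proj (axis 2 1) = \<i>"
      by (simp_all add: plane_proj_def axis_def complex_eq_iff)
    then have "balanced_lift 1 = axis 1 1" "balanced_lift \<i> = axis 2 1"
      using lift [of 1] lift [of 2] by simp_all
    moreover have "maxabs (axis 1 1) = 1" "maxabs (axis 2 1) = 1"
      by (simp_all add: maxabs_def axis_def)
    ultimately show "outer_conf 1 = split_parts (axis 1 1)" "outer_conf \<i> = split_parts (axis 2 1)"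
      by (simp_all add: outer_conf_def)
  qed
  have norm: "weighted_norm L (axis i 1) = edge_length L i" for i
  proof -
    have "weighted_norm L (axis i 1) = (\<Sum>j\<in>UNIV. if j = i then edge_length L i else 0)"
      unfolding weighted_norm_def by (rule sum.cong) (auto simp: axis_def)
    then show ?thesis by simp
  qed
  have notin: "split_parts (axis i 1) \<notin> Y_conf2 r L" if "edge_length L i < r" for i
    using that mem_Y_conf2 [OF assms(1), of "fst (split_parts (axis i 1))" "snd (split_parts (axis i 1))" r]
    by (simp add: split_parts_diff norm)
  from assms(2) show ?thesis
  proof
    assume "L < r"
    then show ?thesis
      using notin [of 1] by (intro exI [of _ 0]) (simp add: eq edge_length_def)
  next
    assume "1 < r"
    then show ?thesis
      using notin [of 2] by (intro exI [of _ "pi / 2"]) (simp add: eq edge_length_def)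
  qed
qed

section \<open>Interval modules and the persistence module\<close>

text \<open>All spaces have dimension at most one, so each summand is zero or everything at each
  index, and on \<open>I\<close> exactly one of the two is zero. Structure maps inside
  \<open>I\<close> are injective, so this choice is constant along relations and, by connectedness,
  on all of \<open>I\<close>; then one summand is zero everywhere.\<close>

lemma indecomposable_if_iso_interval:
  fixes M :: "('p, 'f::field, 'v) pmodule"
  assumes M: "persistence_module P leq M" and I: "poset_interval P leq I"
    and iso: "pmodule_iso P leq M (interval_module I)"
  shows "indecomposable P leq M"
  unfolding indecomposable_def
proof (intro notI, elim exE conjE)
  fix U W
  assume U: "persistence_submodule P leq U M" and W: "persistence_submodule P leq W M"
    and nz: "nonzero_submodule P U M" "nonzero_submodule P W M"
    and sum: "internal_direct_sum P U W M"
  obtain \<eta> where \<eta>: "\<And>t. t \<in> P \<Longrightarrow> \<eta> t \<in> linear_maps (pspace M t) (pspace (interval_module I) t)"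
    and bij: "\<And>t. t \<in> P \<Longrightarrow> bij_betw (\<eta> t) (carrier (pspace M t)) (carrier (pspace (interval_module I) t))"
    and nat: "\<And>s t v. \<lbrakk>s \<in> P; t \<in> P; leq s t; v \<in> carrier (pspace M s)\<rbrakk>
      \<Longrightarrow> \<eta> t (pmap M s t v) = pmap (interval_module I) s t (\<eta> s v)"
    using iso unfolding pmodule_iso_def by blast
  have IP: "I \<subseteq> P"
    using I by (simp add: poset_interval_def)
  let ?z = "\<lambda>t. \<zero>\<^bsub>pspace M t\<^esub>"
  have vs: "vector_space_over_field (pspace M t)" if "t \<in> P" for t
    using M that by (simp add: persistence_module_def)
  have z: "?z t \<in> carrier (pspace M t)" if "t \<in> P" for t
  proof -
    interpret Module.module scalar_field "pspace M t" by (rule vs [OF that])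
    show ?thesis by simp
  qed
  have \<eta>_smult: "\<eta> t (a \<odot>\<^bsub>pspace M t\<^esub> v) = a * \<eta> t v" if "t \<in> P" "v \<in> carrier (pspace M t)" for t a v
    using \<eta> [OF that(1)] that(2) by (simp add: linear_maps_def interval_module_def)
  have inj: "v = w" if "\<eta> t v = \<eta> t w" "t \<in> P" "v \<in> carrier (pspace M t)" "w \<in> carrier (pspace M t)" for t v w
    using bij [OF that(2)] that by (auto simp: bij_betw_def inj_on_def)
  have \<eta>_z: "\<eta> t (?z t) = 0" if "t \<in> P" for t
  proof -
    interpret Module.module scalar_field "pspace M t" by (rule vs [OF that])
    show ?thesis
      using \<eta>_smult [OF that z [OF that], of 0] smult_l_null [OF z [OF that]] by (simp add: scalar_field_def)
  qed
  have sub: "?z t \<in> X t" "X t \<subseteq> carrier (pspace M t)"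
    "\<And>a v. v \<in> X t \<Longrightarrow> a \<odot>\<^bsub>pspace M t\<^esub> v \<in> X t"
    if "persistence_submodule P leq X M" "t \<in> P" for X t
  proof -
    interpret submodule "X t" scalar_field "pspace M t"
      using that by (simp add: persistence_submodule_def)
    show "?z t \<in> X t" "X t \<subseteq> carrier (pspace M t)"
      using one_closed subset by simp_all
    show "a \<odot>\<^bsub>pspace M t\<^esub> v \<in> X t" if "v \<in> X t" for a v
      using smult_closed [of a v] that by (simp add: scalar_field_def)
  qed
  have outside: "X t = {?z t}" if X: "persistence_submodule P leq X M" and t: "t \<in> P" "t \<notin> I" for X t
  proof -
    have "v = ?z t" if "v \<in> carrier (pspace M t)" for v
      using bij_betwE [OF bij [OF t(1)]] t that z [OF t(1)]
      by (intro inj [OF _ t(1)]) (auto simp: interval_module_def)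
    then show ?thesis
      using sub [OF X t(1)] by auto
  qed
  have whole: "X t = carrier (pspace M t)"
    if X: "persistence_submodule P leq X M" and t: "t \<in> P" and ne: "X t \<noteq> {?z t}" for X t
  proof -
    obtain u where u: "u \<in> X t" "u \<noteq> ?z t"
      using ne sub(1) [OF X t] by auto
    have uc: "u \<in> carrier (pspace M t)"
      using u sub(2) [OF X t] by auto
    have "\<eta> t u \<noteq> 0"
      using inj [of t u "?z t"] uc z t u(2) \<eta>_z by auto
    have "v \<in> X t" if v: "v \<in> carrier (pspace M t)" for v
    proof -
      have mem: "(\<eta> t v / \<eta> t u) \<odot>\<^bsub>pspace M t\<^esub> u \<in> X t"
        by (rule sub(3) [OF X t u(1)])
      have "v = (\<eta> t v / \<eta> t u) \<odot>\<^bsub>pspace M t\<^esub> u"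
        using \<open>\<eta> t u \<noteq> 0\<close> sub(2) [OF X t] mem v uc t by (intro inj [of t]) (auto simp: \<eta>_smult)
      with mem show ?thesis by simp
    qed
    then show ?thesis
      using sub(2) [OF X t] by auto
  qed
  have excl: "(U t = {?z t}) \<noteq> (W t = {?z t})" if t: "t \<in> I" for t
  proof -
    have tP: "t \<in> P" using t IP by auto
    interpret Module.module scalar_field "pspace M t" by (rule vs [OF tP])
    have "\<exists>v\<in>carrier (pspace M t). \<eta> t v = 1"
      using bij [OF tP] t by (auto simp: bij_betw_def interval_module_def image_iff)
         (metis (no_types, lifting) UNIV_I image_iff)
    then obtain v where v: "v \<in> carrier (pspace M t)" "v \<noteq> ?z t"
      using \<eta>_z [OF tP] by force
    have ex1: "\<exists>!(u, w). u \<in> U t \<and> w \<in> W t \<and> v = u \<oplus>\<^bsub>pspace M t\<^esub> w"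
      using sum tP v(1) by (auto simp: internal_direct_sum_def)
    show ?thesis
    proof (cases "U t = {?z t}")
      case True
      have "W t \<noteq> {?z t}"
        using ex1 True v by auto
      with True show ?thesis by simp
    next
      case False
      have "W t = {?z t}"
      proof (rule ccontr)
        assume "W t \<noteq> {?z t}"
        then have "U t = carrier (pspace M t)" "W t = carrier (pspace M t)"
          using whole [OF U tP False] whole [OF W tP] by simp_all
        \<comment> \<open>If both summands are the whole space, \<open>v\<close> has two
          decompositions.\<close>
        then have "(THE (u, w). u \<in> U t \<and> w \<in> W t \<and> v = u \<oplus>\<^bsub>pspace M t\<^esub> w) = (v, ?z t)"
          "(THE (u, w). u \<in> U t \<and> w \<in> W t \<and> v = u \<oplus>\<^bsub>pspace M t\<^esub> w) = (?z t, v)"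
          using v(1) by (intro the1_equality [OF ex1]; simp)+
        with v(2) show False by simp
      qed
      with False show ?thesis by simp
    qed
  qed
  have down: "X s = {?z s}"
    if X: "persistence_submodule P leq X M" and st: "s \<in> I" "t \<in> I" "leq s t" and Xt: "X t = {?z t}" for X s t
  proof -
    have P: "s \<in> P" "t \<in> P" using st IP by auto
    have "u = ?z s" if u: "u \<in> X s" for u
    proof -
      have uc: "u \<in> carrier (pspace M s)"
        using sub(2) [OF X P(1)] u by auto
      have "pmap M s t u \<in> X t"
        using X P st(3) u unfolding persistence_submodule_def by blast
      then have "\<eta> s u = 0"
        using nat [OF P st(3) uc] Xt \<eta>_z [OF P(2)] st(1,2) by (simp add: interval_module_def)
      then show ?thesis
        using inj [OF _ P(1) uc z [OF P(1)]] \<eta>_z [OF P(1)] by simp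
    qed
    then show ?thesis
      using sub(1) [OF X P(1)] by blast
  qed
  \<comment> \<open>Vanishing passes to smaller indices by \<open>down\<close>; the converse is the
    same fact for the other summand, translated by \<open>excl\<close>.\<close>
  have edge: "(U s = {?z s}) = (U t = {?z t})" if "s \<in> I" "t \<in> I" "leq s t" for s t
    using down [OF U that] down [OF W that] excl [OF that(1)] excl [OF that(2)] by argo
  have const: "(U s = {?z s}) = (U t = {?z t})" if "s \<in> I" "t \<in> I" for s t
  proof -
    have "(s, t) \<in> {(x, y). x \<in> I \<and> y \<in> I \<and> (leq x y \<or> leq y x)}\<^sup>*"
      using I that by (simp add: poset_interval_def poset_connected_def)
    then show ?thesis
      by induction (use edge in blast)+
  qed
  obtain s where s: "s \<in> P" "U s \<noteq> {?z s}"
    using nz(1) by (auto simp: nonzero_submodule_def)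
  obtain t where t: "t \<in> P" "W t \<noteq> {?z t}"
    using nz(2) by (auto simp: nonzero_submodule_def)
  have "s \<in> I" "t \<in> I"
    using outside U W s t by blast+
  then show False
    using const excl s(2) t(2) by blast
qed

definition Y_interval :: "(real \<times> real) set" where
  "Y_interval = {(r, L). 0 < r \<and> r \<le> 1 \<and> r \<le> L}"

lemma poset_interval_Y_interval: "poset_interval param_poset param_le Y_interval"
  unfolding poset_interval_def
proof (intro conjI)
  show "Y_interval \<subseteq> param_poset"
    by (auto simp: Y_interval_def param_poset_def)
  show "poset_convex param_poset param_le Y_interval"
    by (auto simp: poset_convex_def Y_interval_def param_poset_def)
  let ?R = "{(x, y). x \<in> Y_interval \<and> y \<in> Y_interval \<and> (param_le x y \<or> param_le y x)}"
  have "(a, b) \<in> ?R\<^sup>*" if "a \<in> Y_interval" "b \<in> Y_interval" for a b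
  proof -
    obtain r L r' L' where ab: "a = (r, L)" "b = (r', L')"
      by (cases a, cases b)
    \<comment> \<open>A common upper bound, as the order is reversed in the first
      coordinate.\<close>
    define c where "c = (min r r', max L L')"
    have "(a, c) \<in> ?R" "(c, b) \<in> ?R"
      using that by (auto simp: ab c_def Y_interval_def)
    then show ?thesis
      by (meson converse_rtrancl_into_rtrancl r_into_rtrancl)
  qed
  moreover have "(1, 1) \<in> Y_interval"
    by (simp add: Y_interval_def)
  ultimately show "poset_connected param_le Y_interval"
    by (auto simp: poset_connected_def)
qed

text \<open>Differences are balanced and thus determined by their projection to the plane;
  projection \<open>0\<close> would mean \<open>x = y\<close>, which is excluded by
  \<open>0 < r\<close>.\<close>

lemma Y_conf2_circle_retraction:
  assumes "(r, L) \<in> param_poset"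
  shows "circle_retraction (Y_conf2 r L) conf_direction outer_conf"
proof
  have rL: "0 < r" "0 < L"
    using assms by (auto simp: param_poset_def)
  show "conf_direction z \<noteq> 0" if z: "z \<in> Y_conf2 r L" for z
  proof
    assume 0: "conf_direction z = 0"
    obtain x y where xy: "z = (x, y)" by (cases z)
    have Y: "x \<in> Y_graph" "y \<in> Y_graph" "r \<le> weighted_norm L (x - y)"
      using z rL by (auto simp: xy mem_Y_conf2)
    have "balanced_lift 0 = x - y"
      using balanced_lift_plane_proj [OF balanced_diff [OF Y(1,2)]] 0 by (simp add: conf_direction_def xy)
    moreover have "balanced_lift 0 = 0"
      by (simp add: balanced_lift_def median0_def)
    ultimately show False
      using Y(3) rL weighted_norm_pos_imp [of L "x - y"] by simp
  qed
  show "closed_segment z (outer_conf (conf_direction z)) \<subseteq> Y_conf2 r L" if "z \<in> Y_conf2 r L" for z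
    using Y_conf2_segment rL that by blast
qed (simp_all add: continuous_on_conf_direction continuous_on_outer_conf outer_conf_scale)

lemma Y_conf2_space_subtopology:
  assumes "s \<in> param_poset" "param_le s t"
  shows "\<exists>S. Y_conf2_space s = subtopology (Y_conf2_space t) S"
proof -
  obtain r L r' L' where st: "s = (r, L)" "t = (r', L')"
    by (cases s, cases t)
  have "Y_conf2 r L \<subseteq> Y_conf2 r' L'"
    using assms by (intro Y_conf2_mono) (auto simp: st param_poset_def)
  then show ?thesis
    by (intro exI [of _ "Y_conf2 r L"]) (simp add: st Y_conf2_space_def subtopology_subtopology Int_absorb1)
qed

text \<open>Structure maps keep the representative unchanged, which reduces functoriality and
  naturality to statements about chains.\<close>

lemma PH_Y_pmap:
  assumes "s \<in> param_poset" "param_le s t" "c \<in> field_cycles i (Y_conf2_space s)"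
  shows "pmap (PH_Y i) s t (homology_class i (Y_conf2_space s) c) = homology_class i (Y_conf2_space t) c"
    and "c \<in> field_cycles i (Y_conf2_space t)"
proof -
  obtain S where S: "Y_conf2_space s = subtopology (Y_conf2_space t) S"
    using Y_conf2_space_subtopology [OF assms(1,2)] by blast
  have "c \<in> field_chains i (Y_conf2_space s)"
    using assms(3) by (simp add: field_cycles_def)
  from field_hom_induced_inclusion [OF S this]
  show "pmap (PH_Y i) s t (homology_class i (Y_conf2_space s) c) = homology_class i (Y_conf2_space t) c"
    by (simp add: PH_Y_def)
  show "c \<in> field_cycles i (Y_conf2_space t)"
    using field_cycles_mono [OF S] assms(3) by blast
qed

lemma param_le_refl: "param_le t t"
  by (cases t) simp

lemma param_le_trans: "param_le s t \<Longrightarrow> param_le t u \<Longrightarrow> param_le s u"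
  by (cases s; cases t; cases u) auto

lemma persistence_module_PH_Y:
  "persistence_module param_poset param_le (PH_Y i :: 'f::field Y_pmodule)"
  unfolding persistence_module_def
proof (intro conjI ballI impI)
  let ?M = "PH_Y i :: 'f Y_pmodule"
  have space: "pspace ?M t = field_homology i (Y_conf2_space t)" for t
    by (simp add: PH_Y_def)
  have vs: "vector_space_over_field (pspace ?M t)" for t
    by (simp add: space vector_space_field_homology)
  then show "vector_space_over_field (pspace ?M t)" for t .
  show "pmap ?M s t \<in> linear_maps (pspace ?M s) (pspace ?M t)"
    if st: "s \<in> param_poset" "param_le s t" for s t
  proof -
    note cycles = chain.subspace_add [OF subspace_field_cycles] chain.subspace_scale [OF subspace_field_cycles]
    show ?thesis
      by (auto simp: linear_maps_def space carrier_field_homology field_homology_add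
          field_homology_smult cycles PH_Y_pmap(1) [OF st] intro!: imageI PH_Y_pmap(2) [OF st])
  qed
  show "pmap ?M t t v = v" if "t \<in> param_poset" "v \<in> carrier (pspace ?M t)" for t v
    using that(2) by (auto simp: space carrier_field_homology PH_Y_pmap(1) [OF that(1) param_le_refl])
  show "pmap ?M s u v = pmap ?M t u (pmap ?M s t v)"
    if "s \<in> param_poset" "t \<in> param_poset" "param_le s t" "param_le t u" "v \<in> carrier (pspace ?M s)" for s t u v
    using that(5)
    by (auto simp: space carrier_field_homology PH_Y_pmap [OF that(1,3)]
        PH_Y_pmap(1) [OF that(1) param_le_trans [OF that(3,4)]] PH_Y_pmap(1) [OF that(2,4)])
qed

lemma winding_functional_Y_boundary:
  assumes "t \<in> param_poset" "c \<in> field_boundaries 1 (Y_conf2_space t)"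
  shows "winding_functional conf_direction c = 0"
proof -
  obtain r L where t: "t = (r, L)" by (cases t)
  interpret circle_retraction "Y_conf2 r L" conf_direction outer_conf
    using assms(1) by (auto simp: t intro: Y_conf2_circle_retraction)
  show ?thesis
    using assms(2) by (intro winding_functional_boundary [OF _ cont_\<Phi> \<Phi>_nonzero]) (simp_all add: t Y_conf2_space_def)
qed

text \<open>Outside \<open>Y_interval\<close> a direction is missing and every cycle bounds; inside,
  a cycle is homologous to its winding number times the full circle. Boundaries have winding number
  \<open>0\<close> in either case.\<close>

lemma Y_cycle_boundary_iff:
  assumes t: "t \<in> param_poset" and c: "c \<in> field_cycles 1 (Y_conf2_space t)"
  shows "c \<in> field_boundaries 1 (Y_conf2_space t) \<longleftrightarrow> winding_functional conf_direction c = 0"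
    and "t \<notin> Y_interval \<Longrightarrow> winding_functional conf_direction c = 0"
proof -
  obtain r L where rL: "t = (r, L)" by (cases t)
  interpret circle_retraction "Y_conf2 r L" conf_direction outer_conf
    using t by (auto simp: rL intro: Y_conf2_circle_retraction)
  have c': "c \<in> field_cycles 1 (top_of_set (Y_conf2 r L))"
    using c by (simp add: rL Y_conf2_space_def)
  have out: "c \<in> field_boundaries 1 (Y_conf2_space t)" if "t \<notin> Y_interval"
  proof -
    have "0 < L" "L < r \<or> 1 < r"
      using that t by (auto simp: rL Y_interval_def param_poset_def)
    then obtain a where "outer_conf (cis a) \<notin> Y_conf2 r L"
      using outer_conf_notin_Y_conf2 by blast
    then show ?thesis
      using cycle_null_homologous [OF _ c'] by (simp add: rL Y_conf2_space_def)
  qed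
  then show "t \<notin> Y_interval \<Longrightarrow> winding_functional conf_direction c = 0"
    using winding_functional_Y_boundary [OF t] by blast
  have "c \<in> field_boundaries 1 (Y_conf2_space t)"
    if "t \<in> Y_interval" "winding_functional conf_direction c = 0"
    using cycle_homologous_winding [OF _ c'] outer_conf_in_Y_conf2 that
    by (auto simp: rL Y_conf2_space_def Y_interval_def)
  then show "c \<in> field_boundaries 1 (Y_conf2_space t) \<longleftrightarrow> winding_functional conf_direction c = 0"
    using out winding_functional_Y_boundary [OF t] by blast
qed

lemma Y_generator:
  assumes "t \<in> Y_interval"
  shows "\<exists>c\<in>field_cycles 1 (Y_conf2_space t). winding_functional conf_direction c = (1 :: 'f::field)"
proof -
  obtain r L where rL: "t = (r, L)" "0 < r" "r \<le> 1" "r \<le> L"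
    using assms by (auto simp: Y_interval_def)
  interpret circle_retraction "Y_conf2 r L" conf_direction outer_conf
    using rL by (auto intro: Y_conf2_circle_retraction simp: param_poset_def)
  have full: "outer_conf w \<in> Y_conf2 r L" if "w \<noteq> 0" for w
    using outer_conf_in_Y_conf2 rL that by blast
  have pos: "\<exists>c>0. conf_direction (outer_conf w) = of_real c * w" if "w \<noteq> 0" for w
    using conf_direction_outer_conf [of w] maxabs_pos [OF balanced_lift_nonzero [OF that]]
      positive_imp_inverse_positive by blast
  show ?thesis
    using arc_generator [OF full pos, where 'f = 'f] by (auto simp: rL Y_conf2_space_def)
qed

lemma winding_functional_add: "winding_functional \<Phi> (c + d) = winding_functional \<Phi> c + winding_functional \<Phi> d"
  and winding_functional_diff: "winding_functional \<Phi> (c - d) = winding_functional \<Phi> c - winding_functional \<Phi> d"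
  and winding_functional_smult: "winding_functional \<Phi> (chain_smult a c) = a * winding_functional \<Phi> c"
  by (simp_all add: winding_functional_def vector_space_over_itself.linear_ext_add
      vector_space_over_itself.linear_ext_diff vector_space_over_itself.linear_ext_smult)

lemma PH_Y_iso_interval_module:
  "pmodule_iso param_poset param_le (PH_Y 1 :: 'f::field Y_pmodule) (interval_module Y_interval)"
proof -
  let ?M = "PH_Y 1 :: 'f Y_pmodule" and ?N = "interval_module Y_interval :: (_, 'f, 'f) pmodule"
  \<comment> \<open>Any representative of the class will do, since two of them differ by a boundary,
    where the functional vanishes.\<close>
  define \<eta> :: "real \<times> real \<Rightarrow> _ \<Rightarrow> 'f"
    where "\<eta> = (\<lambda>t A. winding_functional conf_direction (SOME c. c \<in> A))"
  have \<eta>: "\<eta> t (homology_class 1 (Y_conf2_space t) c) = winding_functional conf_direction c"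
    if "t \<in> param_poset" for t c
  proof -
    define d where "d = (SOME d. d \<in> homology_class 1 (Y_conf2_space t) c)"
    have "d \<in> homology_class 1 (Y_conf2_space t) c"
      unfolding d_def by (rule someI) (rule self_mem_homology_class)
    then have "winding_functional conf_direction (d - c) = 0"
      using winding_functional_Y_boundary [OF that] by (simp only: mem_homology_class)
    then show ?thesis
      unfolding \<eta>_def d_def [symmetric] by (simp add: winding_functional_diff)
  qed
  have space: "carrier (pspace ?M t) = homology_class 1 (Y_conf2_space t) ` field_cycles 1 (Y_conf2_space t)" for t
    by (simp add: PH_Y_def carrier_field_homology)
  have into: "\<eta> t v \<in> carrier (pspace ?N t)" if t: "t \<in> param_poset" and v: "v \<in> carrier (pspace ?M t)" for t v
    using v \<eta> [OF t] Y_cycle_boundary_iff(2) [OF t]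
    by (auto simp: space interval_module_def simp del: One_nat_def)
  have lin: "\<eta> t \<in> linear_maps (pspace ?M t) (pspace ?N t)" if t: "t \<in> param_poset" for t
    unfolding linear_maps_def
  proof (intro CollectI conjI funcsetI ballI allI)
    fix u v assume "u \<in> carrier (pspace ?M t)" "v \<in> carrier (pspace ?M t)"
    then show "\<eta> t (u \<oplus>\<^bsub>pspace ?M t\<^esub> v) = \<eta> t u \<oplus>\<^bsub>pspace ?N t\<^esub> \<eta> t v"
      by (auto simp: PH_Y_def carrier_field_homology field_homology_add \<eta> [OF t] winding_functional_add
          interval_module_def simp del: One_nat_def)
  next
    fix a v assume "v \<in> carrier (pspace ?M t)"
    then show "\<eta> t (a \<odot>\<^bsub>pspace ?M t\<^esub> v) = a \<odot>\<^bsub>pspace ?N t\<^esub> \<eta> t v"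
      by (auto simp: PH_Y_def carrier_field_homology field_homology_smult \<eta> [OF t] winding_functional_smult
          interval_module_def simp del: One_nat_def)
  qed (rule into [OF t])
  have bij: "bij_betw (\<eta> t) (carrier (pspace ?M t)) (carrier (pspace ?N t))" if t: "t \<in> param_poset" for t
    unfolding bij_betw_def
  proof
    show "inj_on (\<eta> t) (carrier (pspace ?M t))"
    proof (rule inj_onI)
      fix u v assume uv: "u \<in> carrier (pspace ?M t)" "v \<in> carrier (pspace ?M t)" "\<eta> t u = \<eta> t v"
      then obtain c d where cd: "c \<in> field_cycles 1 (Y_conf2_space t)" "d \<in> field_cycles 1 (Y_conf2_space t)"
        "u = homology_class 1 (Y_conf2_space t) c" "v = homology_class 1 (Y_conf2_space t) d"
        unfolding space by blast
      then have "c - d \<in> field_boundaries 1 (Y_conf2_space t)"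
        using uv(3) \<eta> [OF t] Y_cycle_boundary_iff(1) [OF t chain.subspace_diff [OF subspace_field_cycles cd(1,2)]]
        by (simp add: winding_functional_diff)
      then show "u = v"
        by (simp add: cd homology_class_eq_iff)
    qed
    show "\<eta> t ` carrier (pspace ?M t) = carrier (pspace ?N t)"
    proof
      show "\<eta> t ` carrier (pspace ?M t) \<subseteq> carrier (pspace ?N t)"
        using into [OF t] by auto
      show "carrier (pspace ?N t) \<subseteq> \<eta> t ` carrier (pspace ?M t)"
      proof
        fix a assume a: "a \<in> carrier (pspace ?N t)"
        have "\<exists>c\<in>field_cycles 1 (Y_conf2_space t). winding_functional conf_direction c = a"
        proof (cases "t \<in> Y_interval")
          case True
          then obtain c where c: "c \<in> field_cycles 1 (Y_conf2_space t)" "winding_functional conf_direction c = (1 :: 'f)"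
            using Y_generator by blast
          then show ?thesis
            using chain.subspace_scale [OF subspace_field_cycles c(1), of a]
            by (intro bexI [of _ "chain_smult a c"]) (simp_all add: winding_functional_smult)
        next
          case False
          then have "a = 0"
            using a by (simp add: interval_module_def)
          then show ?thesis
            using chain.subspace_0 [OF subspace_field_cycles] Y_cycle_boundary_iff(2) [OF t _ False] by blast
        qed
        then show "a \<in> \<eta> t ` carrier (pspace ?M t)"
          unfolding space image_image \<eta> [OF t] by blast
      qed
    qed
  qed
  have nat: "\<eta> t (pmap ?M s t v) = pmap ?N s t (\<eta> s v)"
    if st: "s \<in> param_poset" "t \<in> param_poset" "param_le s t" and v: "v \<in> carrier (pspace ?M s)" for s t v
  proof -
    obtain c where c: "c \<in> field_cycles 1 (Y_conf2_space s)" "v = homology_class 1 (Y_conf2_space s) c"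
      using v unfolding space by blast
    \<comment> \<open>This excludes a relation that leaves the interval, where the map of the
      interval module would be zero although the winding number of \<open>c\<close> may not
      be.\<close>
    have up: "s \<in> Y_interval \<Longrightarrow> t \<in> Y_interval"
      using st by (cases s; cases t) (auto simp: Y_interval_def param_poset_def)
    have "\<eta> t (pmap ?M s t v) = winding_functional conf_direction c"
      using PH_Y_pmap(1) [OF st(1,3) c(1)] \<eta> [OF st(2)] by (simp add: c(2))
    moreover have "\<eta> s v = winding_functional conf_direction c"
      using \<eta> [OF st(1)] by (simp add: c(2))
    ultimately show ?thesis
      using up Y_cycle_boundary_iff(2) [OF st(1) c(1)] by (auto simp: interval_module_def)
  qed
  show ?thesis
    unfolding pmodule_iso_def using lin bij nat by blast
qed

theorem theorem1p1:
  shows "persistence_module param_poset param_le (PH_Y 1 :: 'f::field Y_pmodule) \<and>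
    (\<exists>I. poset_interval param_poset param_le I \<and>
         pmodule_iso param_poset param_le (PH_Y 1 :: 'f Y_pmodule) (interval_module I)) \<and>
    indecomposable param_poset param_le (PH_Y 1 :: 'f Y_pmodule)"
  using persistence_module_PH_Y poset_interval_Y_interval PH_Y_iso_interval_module
    indecomposable_if_iso_interval by blast

end
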